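(* Let $\rho_0\in\mathcal{P}(\mathbb{R})$ and $v_0\in C(\mathbb{R})$ both be supported in $[0,1]$. Let $(\rho,v)$ be the sticky particles solution (SPS) on $\mathbb{R}$ with initial data $(\rho_0,v_0)$, and for $t\ge0$ let $N(t,\cdot)$ be the right-continuous nondecreasing map pushing Lebesgue measure on $(0,1)$ forward to $\rho(t,\cdot)$. If the evolution is confined to $[0,1]$, i.e. $\mathrm{spt}(\rho(t,\cdot))\subset[0,1]$ for all $t\ge0$, then there exists a right-continuous, nondecreasing function $N_\infty:[0,1]\to[0,1]$ such that $$\lim_{t\to\infty}N(t,x)=N_\infty(x)\quad\text{for a.e. }x\in[0,1].$$
   Context: $\mathcal{P}(\mathbb{R})$ denotes Borel probability measures on $\mathbb{R}$, $\mathcal{P}_2(\mathbb{R})$ those with finite second moment, $C_b(\mathbb{R})$ the bounded continuous functions; narrow convergence is convergence against $C_b(\mathbb{R})$. For $\rho_0\in\mathcal{P}_2(\mathbb{R})$ and $v_0\in C_b(\mathbb{R})$, the sticky particles solution (SPS) on $\mathbb{R}$ with data $(\rho_0,v_0)$ is a pair $(\rho,v)$, with $\rho:[0,\infty)\to\mathcal{P}(\mathbb{R})$ narrowly continuous and $v:[0,\infty)\times\mathbb{R}\to\mathbb{R}$ Borel, such that: (1) $\int_0^T\int v^2\,\rho(t,dy)\,dt<\infty$ for all $T>0$; (2) $\int_0^\infty\int(\partial_t\phi+v\partial_y\phi)\,\rho(t,dy)\,dt+\int\phi(0,y)\,\rho_0(dy)=0$ for all $\phi\in C^1_c([0,\infty)\times\mathbb{R})$;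 (3) $\int_0^\infty\int(v\partial_t\phi+v^2\partial_y\phi)\,\rho(t,dy)\,dt+\int\phi(0,y)v_0(y)\,\rho_0(dy)=0$ for all $\phi\in C^1_c([0,\infty)\times\mathbb{R})$; (4) for all $t>0$ and all $y_1<y_2$, $\frac{v(t,y_2)-v(t,y_1)}{y_2-y_1}\le\frac1t$; (5) for all $\phi\in C_b(\mathbb{R})$, $\int v^2(t,y)\phi(y)\,\rho(t,dy)\to\int v_0^2(y)\phi(y)\,\rho_0(dy)$ as $t\to0^+$. Such a pair exists and $\rho$ is uniquely determined. *)

theory Defs
  imports "HOL-Probability.Probability"
begin

text \<open>
  Borel probability measures on the real line are rendered by the library locale predicate
  \<^locale>\<open>real_distribution\<close>.  A curve of measures on \<open>[0,\<infinity>)\<close> is a function on \<^typ>\<open>real\<close>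
  whose values at negative times are irrelevant.
\<close>

definition spt :: "'a::topological_space measure \<Rightarrow> 'a set" where
  "spt \<mu> = {x. \<forall>U. open U \<longrightarrow> x \<in> U \<longrightarrow> emeasure \<mu> U > 0}"

definition finite_second_moment :: "real measure \<Rightarrow> bool" where
  "finite_second_moment \<mu> \<longleftrightarrow> integrable \<mu> (\<lambda>y. y\<^sup>2)"

definition C_b :: "(real \<Rightarrow> real) set" where
  "C_b = {\<phi>. continuous_on UNIV \<phi> \<and> bounded (range \<phi>)}"

definition narrowly_continuous :: "(real \<Rightarrow> real measure) \<Rightarrow> bool" where
  "narrowly_continuous \<rho> \<longleftrightarrow>
     (\<forall>\<phi>\<in>C_b. continuous_on {0..} (\<lambda>t. LINT y|\<rho> t. \<phi> y))"

text \<open>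
  \<open>C1c \<phi> \<phi>t \<phi>y\<close>: \<open>\<phi>\<close> is a \<open>C\<^sup>1\<close> function on \<open>[0,\<infinity>) \<times> \<real>\<close> with compact support there (it need
  not vanish at \<open>t = 0\<close>), and \<open>\<phi>t\<close>, \<open>\<phi>y\<close> are its partial derivatives, the time derivative
  being one-sided at \<open>t = 0\<close>.
\<close>

definition C1c ::
  "(real \<Rightarrow> real \<Rightarrow> real) \<Rightarrow> (real \<Rightarrow> real \<Rightarrow> real) \<Rightarrow> (real \<Rightarrow> real \<Rightarrow> real) \<Rightarrow> bool" where
  "C1c \<phi> \<phi>t \<phi>y \<longleftrightarrow>
     (\<forall>t\<ge>0. \<forall>y. ((\<lambda>s. \<phi> s y) has_real_derivative \<phi>t t y) (at t within {0..})
               \<and> ((\<lambda>z. \<phi> t z) has_real_derivative \<phi>y t y) (at y)) \<and>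
     continuous_on ({0..} \<times> UNIV) (\<lambda>(t, y). \<phi>t t y) \<and>
     continuous_on ({0..} \<times> UNIV) (\<lambda>(t, y). \<phi>y t y) \<and>
     (\<exists>K. compact K \<and> (\<forall>t\<ge>0. \<forall>y. (t, y) \<notin> K \<longrightarrow> \<phi> t y = 0))"

text \<open>
  Bochner integrals of non-integrable functions are 0 by convention.  In the two weak equations
  the integrability condition on \<open>v\<^sup>2\<close> rules this out.  In the last condition, convergence to a
  finite limit for \<open>\<phi> = 1\<close> presupposes that \<open>v\<^sup>2\<close> is \<open>\<rho> t\<close>-integrable for all small \<open>t > 0\<close>,
  which is therefore stated explicitly.
\<close>

definition sticky_particles_solution ::
  "real measure \<Rightarrow> (real \<Rightarrow> real) \<Rightarrow> (real \<Rightarrow> real measure) \<Rightarrow> (real \<Rightarrow> real \<Rightarrow> real) \<Rightarrow> bool" where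
  "sticky_particles_solution \<rho>0 v0 \<rho> v \<longleftrightarrow>
     real_distribution \<rho>0 \<and> finite_second_moment \<rho>0 \<and> v0 \<in> C_b \<and>
     (\<forall>t\<ge>0. real_distribution (\<rho> t)) \<and> narrowly_continuous \<rho> \<and>
     (\<lambda>(t, y). v t y) \<in> borel_measurable (restrict_space borel ({0..} \<times> UNIV)) \<and>
     (\<forall>T>0. (\<integral>\<^sup>+t\<in>{0..T}. (\<integral>\<^sup>+y. ennreal ((v t y)\<^sup>2) \<partial>\<rho> t) \<partial>lborel) < \<infinity>) \<and>
     (\<forall>\<phi> \<phi>t \<phi>y. C1c \<phi> \<phi>t \<phi>y \<longrightarrow>
        (LINT t:{0..}|lborel. (LINT y|\<rho> t. \<phi>t t y + v t y * \<phi>y t y))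
          + (LINT y|\<rho>0. \<phi> 0 y) = 0) \<and>
     (\<forall>\<phi> \<phi>t \<phi>y. C1c \<phi> \<phi>t \<phi>y \<longrightarrow>
        (LINT t:{0..}|lborel. (LINT y|\<rho> t. v t y * \<phi>t t y + (v t y)\<^sup>2 * \<phi>y t y))
          + (LINT y|\<rho>0. \<phi> 0 y * v0 y) = 0) \<and>
     (\<forall>t>0. \<forall>y1 y2. y1 < y2 \<longrightarrow> (v t y2 - v t y1) / (y2 - y1) \<le> 1 / t) \<and>
     (\<forall>\<^sub>F t in at_right 0. integrable (\<rho> t) (\<lambda>y. (v t y)\<^sup>2)) \<and>
     (\<forall>\<phi>\<in>C_b. ((\<lambda>t. LINT y|\<rho> t. (v t y)\<^sup>2 * \<phi> y)
                 \<longlongrightarrow> (LINT y|\<rho>0. (v0 y)\<^sup>2 * \<phi> y)) (at_right 0))"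

text \<open>Right-continuity relative to \<open>S\<close>; it is vacuous at a maximum of \<open>S\<close>.\<close>

definition right_continuous_on :: "real set \<Rightarrow> (real \<Rightarrow> real) \<Rightarrow> bool" where
  "right_continuous_on S f \<longleftrightarrow> (\<forall>x\<in>S. continuous (at x within (S \<inter> {x..})) f)"

text \<open>
  \<open>X\<close> is the right-continuous nondecreasing map on \<open>(0,1)\<close> pushing Lebesgue measure forward
  to \<open>\<mu>\<close>; these properties determine \<open>X\<close> on \<open>(0,1)\<close>, and its values elsewhere are irrelevant.
\<close>

definition monotone_rearrangement :: "real measure \<Rightarrow> (real \<Rightarrow> real) \<Rightarrow> bool" where
  "monotone_rearrangement \<mu> X \<longleftrightarrow>
     mono_on {0<..<1} X \<and> right_continuous_on {0<..<1} X \<and>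
     distr (restrict_space lborel {0<..<1}) borel X = \<mu>"

end

theory Submission
  imports Defs
begin

text \<open>
  Let \<open>\<psi>\<close> be convex.  Along a solution, the mass and the momentum equation together give, weakly in
  time,
    \<open>d\<^sup>2/dt\<^sup>2 \<integral>\<psi> d\<rho>(t) = \<integral>v\<^sup>2 \<psi>'' d\<rho>(t) \<ge> 0\<close>,
  so the moment \<open>\<integral>\<psi> d\<rho>(t)\<close> is a convex function of time (\<open>sps_weakly_convex\<close>).  Confinement to \<open>[0,1]\<close>
  makes it bounded, and a bounded convex function on a half-line is nonincreasing
  (\<open>weakly_convex_bounded_imp_nonincreasing\<close>), hence convergent as \<open>t \<rightarrow> \<infinity>\<close>.  Since every \<open>C\<^sup>2\<close>
  function is a difference of functions that are convex on \<open>[0,1]\<close>, all \<open>C\<^sup>2\<close> moments converge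
  (\<open>sps_moment_converges\<close>).

  In terms of the rearrangements, \<open>\<integral>\<psi>(N(t,x)) dx\<close> converges for every \<open>C\<^sup>2\<close> function \<open>\<psi>\<close>.  Take for \<open>\<psi>\<close> a
  smooth step from 1 to 0 between \<open>p\<close> and \<open>q\<close>.  If \<open>N(t,x)\<close> were to oscillate across \<open>[p,q]\<close> for ever,
  monotonicity in \<open>x\<close> would force the limit to equal \<open>x\<close>.  So for each pair of rationals this
  happens at one point at most, and \<open>N(t,x)\<close> converges for all but countably many \<open>x\<close>
  (\<open>monotone_family_converges_off_countable\<close>).  The limit is monotone, and its right-continuous
  version agrees with it off a countable set (\<open>monotone_limit_right_continuous_version\<close>).
\<close>

section \<open>Twice continuously differentiable bump functions\<close>

text \<open>
  The derivatives are carried as explicit functions because they occur in the weak equations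
  themselves, where the test functions are \<open>a' \<psi>\<close> and \<open>a \<psi>'\<close>.
\<close>
definition C2 :: "(real \<Rightarrow> real) \<Rightarrow> (real \<Rightarrow> real) \<Rightarrow> (real \<Rightarrow> real) \<Rightarrow> bool" where
  "C2 f f' f'' \<longleftrightarrow>
     (\<forall>x. (f has_real_derivative f' x) (at x)) \<and>
     (\<forall>x. (f' has_real_derivative f'' x) (at x)) \<and> continuous_on UNIV f''"

lemma C2_D1: "C2 f f' f'' \<Longrightarrow> (f has_real_derivative f' x) (at x within A)"
  unfolding C2_def by (blast intro: has_field_derivative_at_within)

lemma C2_D2: "C2 f f' f'' \<Longrightarrow> (f' has_real_derivative f'' x) (at x within A)"
  unfolding C2_def by (blast intro: has_field_derivative_at_within)

lemma C2_continuous_on: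
  assumes "C2 f f' f''"
  shows "continuous_on A f" "continuous_on A f'" "continuous_on A f''"
proof -
  show "continuous_on A f"
    by (rule DERIV_continuous_on) (rule C2_D1[OF assms])
  show "continuous_on A f'"
    by (rule DERIV_continuous_on) (rule C2_D2[OF assms])
  show "continuous_on A f''"
    using assms continuous_on_subset unfolding C2_def by blast
qed

lemma C2_add:
  assumes "C2 f f' f''" "C2 g g' g''"
  shows "C2 (\<lambda>x. f x + g x) (\<lambda>x. f' x + g' x) (\<lambda>x. f'' x + g'' x)"
  using assms unfolding C2_def
  by (auto intro!: derivative_intros continuous_intros)

lemma C2_cmult:
  assumes "C2 f f' f''"
  shows "C2 (\<lambda>x. c * f x) (\<lambda>x. c * f' x) (\<lambda>x. c * f'' x)"
  using assms unfolding C2_def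
  by (auto intro!: DERIV_cmult continuous_intros)

lemma C2_mult:
  assumes "C2 f f' f''" "C2 g g' g''"
  shows "C2 (\<lambda>x. f x * g x) (\<lambda>x. f' x * g x + f x * g' x)
            (\<lambda>x. f'' x * g x + 2 * (f' x * g' x) + f x * g'' x)"
  unfolding C2_def
  apply (auto intro!: derivative_eq_intros C2_D1[OF assms(1)] C2_D1[OF assms(2)]
            C2_D2[OF assms(1)] C2_D2[OF assms(2)] simp: algebra_simps)
  apply (intro continuous_intros C2_continuous_on[OF assms(1)] C2_continuous_on[OF assms(2)])
  done

lemma C2_compose:
  assumes "C2 f f' f''" "C2 g g' g''"
  shows "C2 (\<lambda>x. f (g x)) (\<lambda>x. f' (g x) * g' x)
            (\<lambda>x. f'' (g x) * (g' x)\<^sup>2 + f' (g x) * g'' x)"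
proof -
  have 1: "((\<lambda>x. f (g x)) has_real_derivative f' (g x) * g' x) (at x)" for x
    by (rule DERIV_chain2[OF C2_D1[OF assms(1)] C2_D1[OF assms(2)]])
  have 2: "((\<lambda>x. f' (g x)) has_real_derivative f'' (g x) * g' x) (at x)" for x
    by (rule DERIV_chain2[OF C2_D2[OF assms(1)] C2_D1[OF assms(2)]])
  have 3: "((\<lambda>x. f' (g x) * g' x) has_real_derivative
              f'' (g x) * (g' x)\<^sup>2 + f' (g x) * g'' x) (at x)" for x
    using DERIV_mult[OF 2 C2_D2[OF assms(2)], of x]
    by (simp add: power2_eq_square algebra_simps)
  have c: "continuous_on UNIV (\<lambda>x. h (g x))" if "continuous_on UNIV h" for h :: "real \<Rightarrow> real"
    using continuous_on_compose2[OF that C2_continuous_on(1)[OF assms(2)]] by auto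
  show ?thesis unfolding C2_def
    using 1 3 C2_continuous_on[OF assms(1)] C2_continuous_on[OF assms(2)]
    by (auto intro!: continuous_intros c)
qed

lemma C2_affine: "C2 (\<lambda>x. c + d * x) (\<lambda>x. d) (\<lambda>x. 0)"
  unfolding C2_def by (auto intro!: derivative_eq_intros)

lemma C2_square: "C2 (\<lambda>x. x\<^sup>2) (\<lambda>x. 2 * x) (\<lambda>x. 2)"
  unfolding C2_def by (auto intro!: derivative_eq_intros)

text \<open>
  All bump functions below are built from the cube of the positive part: it is the lowest integer power
  of \<open>max 0 u\<close> that is twice continuously differentiable across the kink.
\<close>
lemma DERIV_pos_part_power:
  "((\<lambda>u::real. (max 0 u) ^ Suc (Suc n)) has_real_derivative
      real (Suc (Suc n)) * (max 0 x) ^ Suc n) (at x)"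
proof -
  consider "x < 0" | "x = 0" | "x > 0" by linarith
  then show ?thesis
  proof cases
    case 1
    have "((\<lambda>u::real. 0) has_real_derivative 0) (at x)" by simp
    then have "((\<lambda>u::real. (max 0 u) ^ Suc (Suc n)) has_real_derivative 0) (at x)"
      by (rule has_field_derivative_transform_within_open[of _ _ _ "{..<0}"]) (use 1 in auto)
    with 1 show ?thesis by simp
  next
    case 2
    have "isCont (\<lambda>z::real. (max 0 z) ^ Suc n) 0" by (intro continuous_intros)
    moreover have "(max 0 z) ^ Suc (Suc n) - (max 0 0) ^ Suc (Suc n) = (max 0 z) ^ Suc n * (z - 0)"
      for z :: real
      by (cases "z \<ge> 0") (auto simp: max_def)
    ultimately have "((\<lambda>u::real. (max 0 u) ^ Suc (Suc n)) has_real_derivative 0) (at 0)"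
      unfolding CARAT_DERIV by (intro exI[of _ "\<lambda>z::real. (max 0 z) ^ Suc n"]) simp
    with 2 show ?thesis by simp
  next
    case 3
    have "((\<lambda>u::real. u ^ Suc (Suc n)) has_real_derivative real (Suc (Suc n)) * x ^ Suc n) (at x)"
      using DERIV_pow[of "Suc (Suc n)" x UNIV] by simp
    then have "((\<lambda>u::real. (max 0 u) ^ Suc (Suc n)) has_real_derivative
                 real (Suc (Suc n)) * x ^ Suc n) (at x)"
      by (rule has_field_derivative_transform_within_open[of _ _ _ "{0<..}"]) (use 3 in auto)
    with 3 show ?thesis by simp
  qed
qed

lemma C2_pos_part_cube: "C2 (\<lambda>u. (max 0 u) ^ 3) (\<lambda>u. 3 * (max 0 u)\<^sup>2) (\<lambda>u. 6 * max 0 u)"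
proof -
  have "((\<lambda>u::real. (max 0 u) ^ 3) has_real_derivative 3 * (max 0 x)\<^sup>2) (at x)" for x
    using DERIV_pos_part_power[of 1 x] by (simp add: eval_nat_numeral)
  moreover have "((\<lambda>u::real. 3 * (max 0 u)\<^sup>2) has_real_derivative 6 * max 0 x) (at x)" for x
    using DERIV_cmult[OF DERIV_pos_part_power[of 0 x], of 3] by (simp add: eval_nat_numeral)
  ultimately show ?thesis unfolding C2_def by (auto intro!: continuous_intros)
qed

text \<open>
  Nesting two positive parts gives a \<open>C\<^sup>2\<close> transition from 1 (left of \<open>p\<close>) to 0 (right of \<open>q\<close>) whose
  values lie in \<open>[0,1]\<close> for trivial reasons.
\<close>
definition smooth_step :: "real \<Rightarrow> real \<Rightarrow> real \<Rightarrow> real" where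
  "smooth_step p q y = (max 0 (1 - (max 0 ((y - p) / (q - p))) ^ 3)) ^ 3"

lemma smooth_step_C2: "\<exists>f' f''. C2 (smooth_step p q) f' f''"
proof -
  have "C2 (\<lambda>y. (y - p) / (q - p)) (\<lambda>y. 1 / (q - p)) (\<lambda>y. 0)"
    using C2_affine[of "- p / (q - p)" "1 / (q - p)"] by (simp add: diff_divide_distrib)
  from C2_compose[OF C2_pos_part_cube C2_compose[OF C2_affine[of 1 "-1"]
        C2_compose[OF C2_pos_part_cube this]]]
  show ?thesis unfolding smooth_step_def[abs_def] by auto
qed

lemma smooth_step_eq_1: "p < q \<Longrightarrow> y \<le> p \<Longrightarrow> smooth_step p q y = 1"
  by (simp add: smooth_step_def max_def field_simps)

lemma smooth_step_eq_0: "p < q \<Longrightarrow> q \<le> y \<Longrightarrow> smooth_step p q y = 0"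
proof -
  assume "p < q" "q \<le> y"
  then have "1 \<le> (y - p) / (q - p)" by (simp add: field_simps)
  then have "1 \<le> (max 0 ((y - p) / (q - p))) ^ 3" by (intro one_le_power) auto
  then show ?thesis unfolding smooth_step_def by simp
qed

lemma smooth_step_bounds: "0 \<le> smooth_step p q y" "smooth_step p q y \<le> 1"
  unfolding smooth_step_def by (auto intro!: power_le_one)

text \<open>
  Test functions must have compact support, whereas the measures only see \<open>[0,1]\<close>.  The cutoff is
  the transition profile applied to \<open>y\<^sup>2 - 1\<close>; since it is constant on \<open>[-1,1]\<close>, multiplying by it
  changes neither a function nor its derivatives on \<open>[0,1]\<close>.
\<close>
lemma ex_cutoff:
  obtains h h' h'' where "C2 h h' h''"
    "\<And>y. y \<in> {0..1} \<Longrightarrow> h y = 1 \<and> h' y = 0 \<and> h'' y = 0"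
    "\<And>y. y \<notin> {-2..2} \<Longrightarrow> h y = 0"
proof -
  have "C2 (\<lambda>y. y\<^sup>2 - 1) (\<lambda>y. 2 * y) (\<lambda>y. 2)"
    using C2_add[OF C2_square C2_affine[of "-1" 0]] by simp
  note C = C2_compose[OF C2_pos_part_cube C2_compose[OF C2_affine[of 1 "-1"]
        C2_compose[OF C2_pos_part_cube this]]]
  show ?thesis
  proof (rule that[OF C])
    fix y :: real assume "y \<in> {0..1}"
    then have "y\<^sup>2 \<le> 1" by (auto intro!: power_le_one)
    then show "(max 0 (1 + - 1 * max 0 (y\<^sup>2 - 1) ^ 3)) ^ 3 = 1 \<and>
        3 * (max 0 (1 + - 1 * max 0 (y\<^sup>2 - 1) ^ 3))\<^sup>2 * (- 1 * (3 * (max 0 (y\<^sup>2 - 1))\<^sup>2 * (2 * y))) = 0 \<and>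
        6 * max 0 (1 + - 1 * max 0 (y\<^sup>2 - 1) ^ 3) * (- 1 * (3 * (max 0 (y\<^sup>2 - 1))\<^sup>2 * (2 * y)))\<^sup>2 +
        3 * (max 0 (1 + - 1 * max 0 (y\<^sup>2 - 1) ^ 3))\<^sup>2 *
        (0 * (3 * (max 0 (y\<^sup>2 - 1))\<^sup>2 * (2 * y))\<^sup>2 +
         - 1 * (6 * max 0 (y\<^sup>2 - 1) * (2 * y)\<^sup>2 + 3 * (max 0 (y\<^sup>2 - 1))\<^sup>2 * 2)) = 0"
      by (simp add: max_def)
  next
    fix y :: real assume "y \<notin> {-2..2}"
    then have "2 \<le> \<bar>y\<bar>" by auto
    then have "2\<^sup>2 \<le> \<bar>y\<bar>\<^sup>2" by (intro power_mono) auto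
    then have "1 \<le> (max 0 (y\<^sup>2 - 1)) ^ 3" by (intro one_le_power) auto
    then show "(max 0 (1 + - 1 * max 0 (y\<^sup>2 - 1) ^ 3)) ^ 3 = 0" by simp
  qed
qed

text \<open>
  The fourth difference, with mesh \<open>d\<close>, of the cube of the positive part: up to a factor this is
  the cubic B-spline with knots \<open>0, d, 2d, 3d, 4d\<close>.  It is nonnegative and compactly supported,
  and its second derivative is six times the second difference of the hat function below.  Tested against
  it, weak convexity becomes an inequality between three consecutive local averages.
\<close>
definition spline :: "real \<Rightarrow> real \<Rightarrow> real" where
  "spline d u = (max 0 u) ^ 3 - 4 * (max 0 (u - d)) ^ 3 + 6 * (max 0 (u - 2 * d)) ^ 3
       - 4 * (max 0 (u - 3 * d)) ^ 3 + (max 0 (u - 4 * d)) ^ 3"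

definition hat :: "real \<Rightarrow> real \<Rightarrow> real" where
  "hat d u = max 0 u - 2 * max 0 (u - d) + max 0 (u - 2 * d)"

lemma spline_C2:
  "\<exists>s'. C2 (spline d) s' (\<lambda>u. 6 * (hat d u - 2 * hat d (u - d) + hat d (u - 2 * d)))"
proof -
  have S: "C2 (\<lambda>u. (max 0 (u - c)) ^ 3) (\<lambda>u. 3 * (max 0 (u - c))\<^sup>2) (\<lambda>u. 6 * max 0 (u - c))" for c
    using C2_compose[OF C2_pos_part_cube C2_affine[of "-c" 1]] by simp
  note T = C2_add[OF C2_add[OF C2_add[OF C2_add[OF S[of 0] C2_cmult[OF S[of d], of "-4"]]
    C2_cmult[OF S[of "2*d"], of "6"]] C2_cmult[OF S[of "3*d"], of "-4"]] S[of "4*d"]]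
  have "spline d = (\<lambda>x. max 0 (x - 0) ^ 3 + - 4 * max 0 (x - d) ^ 3 + 6 * max 0 (x - 2 * d) ^ 3 +
       - 4 * max 0 (x - 3 * d) ^ 3 + max 0 (x - 4 * d) ^ 3)"
    by (simp add: spline_def fun_eq_iff)
  moreover have "(\<lambda>u. 6 * (hat d u - 2 * hat d (u - d) + hat d (u - 2 * d))) =
     (\<lambda>x. 6 * max 0 (x - 0) + - 4 * (6 * max 0 (x - d)) + 6 * (6 * max 0 (x - 2 * d)) +
          - 4 * (6 * max 0 (x - 3 * d)) + 6 * max 0 (x - 4 * d))"
    by (simp add: hat_def fun_eq_iff algebra_simps)
  ultimately show ?thesis using T by metis
qed

text \<open>
  On each knot interval the spline is a cubic; the two middle pieces are mirror images of each
  other, and both reduce to \<open>4a\<^sup>3 \<le> (d + a)\<^sup>3\<close> for \<open>0 \<le> a \<le> d\<close>.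
\<close>
lemma spline_nonneg:
  assumes "d > 0" shows "0 \<le> spline d u"
proof -
  have key: "4 * a ^ 3 \<le> (d + a) ^ 3" if "0 \<le> a" "a \<le> d" for a :: real
  proof -
    have "a ^ 3 \<le> d * a\<^sup>2"
      using mult_right_mono[of a d "a\<^sup>2"] that by (simp add: power3_eq_cube power2_eq_square)
    moreover have "d * a\<^sup>2 \<ge> 0" "d\<^sup>2 * a \<ge> 0" "d ^ 3 \<ge> 0" using that assms by auto
    moreover have "(d + a) ^ 3 = d ^ 3 + 3 * (d\<^sup>2 * a) + 3 * (d * a\<^sup>2) + a ^ 3"
      by (simp add: power3_eq_cube power2_eq_square algebra_simps)
    ultimately show ?thesis by linarith
  qed
  consider "u \<le> d" | "d \<le> u" "u \<le> 2 * d" | "2 * d \<le> u" "u \<le> 3 * d"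
    | "3 * d \<le> u" "u \<le> 4 * d" | "4 * d \<le> u" by linarith
  then show ?thesis
  proof cases
    case 1 then show ?thesis using assms by (simp add: spline_def)
  next
    case 2
    then show ?thesis using key[of "u - d"] assms by (simp add: spline_def)
  next
    case 3
    have "spline d u = (4 * d - u) ^ 3 - 4 * (3 * d - u) ^ 3"
      using 3 assms by (simp add: spline_def power3_eq_cube algebra_simps)
    then show ?thesis using key[of "3 * d - u"] 3 by simp
  next
    case 4
    have "spline d u = (4 * d - u) ^ 3"
      using 4 assms by (simp add: spline_def power3_eq_cube algebra_simps)
    then show ?thesis using 4 by simp
  next
    case 5
    have "spline d u = 0"
      using 5 assms by (simp add: spline_def power3_eq_cube algebra_simps)
    then show ?thesis by simp
  qed
qed

lemma spline_eq_0:
  assumes "d > 0" "u \<le> 0 \<or> 4 * d \<le> u" shows "spline d u = 0"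
  using assms by (auto simp: spline_def power3_eq_cube algebra_simps max_def)

lemma hat_nonneg: "d > 0 \<Longrightarrow> 0 \<le> hat d u"
  unfolding hat_def by (auto simp: max_def)

lemma hat_eq_0: "d > 0 \<Longrightarrow> u \<notin> {0..2 * d} \<Longrightarrow> hat d u = 0"
  unfolding hat_def by (auto simp: max_def)

lemma hat_ge: "d > 0 \<Longrightarrow> u \<in> {d/2..3*d/2} \<Longrightarrow> d / 2 \<le> hat d u"
  unfolding hat_def by (auto simp: max_def)

lemma continuous_on_hat: "continuous_on A (hat d)"
  unfolding hat_def[abs_def] by (intro continuous_intros)

section \<open>Bounded weakly convex functions of time\<close>

text \<open>
  The increments of a convex sequence increase, so a single positive increment would force at
  least linear growth.
\<close>
lemma bounded_discrete_convex_imp_decreasing: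
  fixes x :: "nat \<Rightarrow> real"
  assumes conv: "\<And>k. x k - 2 * x (Suc k) + x (Suc (Suc k)) \<ge> 0"
    and bdd: "\<And>k. \<bar>x k\<bar> \<le> B"
  shows "decseq x"
proof (rule decseq_SucI, rule ccontr)
  fix k assume "\<not> x (Suc k) \<le> x k"
  define h where "h = x (Suc k) - x k"
  have h: "h > 0" using \<open>\<not> _\<close> by (simp add: h_def)
  have slope: "x (Suc (k + j)) - x (k + j) \<ge> h" for j
  proof (induction j)
    case (Suc j)
    then show ?case using conv[of "k + j"] by simp
  qed (simp add: h_def)
  have lin: "x (k + j) \<ge> x k + real j * h" for j
  proof (induction j)
    case (Suc j)
    then show ?case using slope[of j] by (simp add: algebra_simps)
  qed simp
  obtain j where "real j * h > 2 * B" using h reals_Archimedean3 by blast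
  then show False using lin[of j] bdd[of k] bdd[of "k + j"] by linarith
qed

lemma integrable_continuous_supported:
  fixes f :: "real \<Rightarrow> real"
  assumes "continuous_on UNIV f" "\<And>x. x \<notin> {a..b} \<Longrightarrow> f x = 0"
  shows "integrable lborel f"
proof -
  have "set_integrable lborel {a..b} f"
    by (rule borel_integrable_atLeastAtMost') (rule continuous_on_subset[OF assms(1)], simp)
  moreover have "(\<lambda>x. indicator {a..b} x *\<^sub>R f x) = f"
    using assms(2) by (force simp: indicator_def)
  ultimately show ?thesis unfolding set_integrable_def by simp
qed

text \<open>
  The averages \<open>G s\<close> of \<open>g\<close> against a hat function of mesh \<open>d\<close> starting at \<open>s\<close> form a bounded
  convex sequence along every arithmetic progression of step \<open>d\<close> in \<open>[0,\<infinity>)\<close>, so they decrease along it.  If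
  \<open>g t1 < g t2\<close>, a mesh that divides \<open>t2 - t1\<close> and resolves the continuity of \<open>g\<close> near both points
  makes the average at \<open>t1\<close> strictly smaller than the one at \<open>t2\<close>, a contradiction.
\<close>
lemma weakly_convex_bounded_imp_nonincreasing:
  fixes g :: "real \<Rightarrow> real"
  assumes cont: "continuous_on UNIV g" and bdd: "\<And>t. \<bar>g t\<bar> \<le> B"
    and weak: "\<And>a a' a'' T. C2 a a' a'' \<Longrightarrow> (\<And>t. 0 \<le> a t) \<Longrightarrow>
                 (\<And>t. t \<notin> {0<..<T} \<Longrightarrow> a t = 0) \<Longrightarrow> 0 \<le> (LINT t|lborel. a'' t * g t)"
    and t: "0 \<le> t1" "t1 \<le> t2"
  shows "g t2 \<le> g t1"
proof (rule ccontr)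
  assume neg: "\<not> g t2 \<le> g t1"
  \<comment> \<open>Two separated levels between the values, so that the final inequality is strict.\<close>
  define c1 where "c1 = (2 * g t1 + g t2) / 3"
  define c2 where "c2 = (g t1 + 2 * g t2) / 3"
  have c: "g t1 < c1" "c1 < c2" "c2 < g t2" using neg by (auto simp: c1_def c2_def)
  have gc: "continuous (at s) g" for s using cont by (simp add: continuous_on_eq_continuous_at)
  obtain e1 where e1: "e1 > 0" "\<And>r. dist r t1 < e1 \<Longrightarrow> dist (g r) (g t1) < c1 - g t1"
    using gc[of t1] c(1) unfolding continuous_at_eps_delta dist_real_def
    by (metis diff_gt_0_iff_gt)
  obtain e2 where e2: "e2 > 0" "\<And>r. dist r t2 < e2 \<Longrightarrow> dist (g r) (g t2) < g t2 - c2"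
    using gc[of t2] c(3) unfolding continuous_at_eps_delta dist_real_def
    by (metis diff_gt_0_iff_gt)
  have t12: "t1 < t2" using neg t(2) by (cases "t1 = t2") auto
  obtain n where n: "2 * (t2 - t1) / min e1 e2 < real n" using reals_Archimedean2 by blast
  have "0 < 2 * (t2 - t1) / min e1 e2" using t12 e1(1) e2(1) by simp
  then have n0: "real n > 0" using n by linarith
  define d where "d = (t2 - t1) / n"
  have d: "d > 0" using n0 t12 by (simp add: d_def)
  have d2: "2 * d < min e1 e2" 
  proof -
    have "2 * (t2 - t1) < real n * min e1 e2"
      using n e1(1) e2(1) by (simp only: pos_divide_less_eq min_less_iff_conj)
    then show ?thesis using n0 by (simp only: d_def times_divide_eq_right pos_divide_less_eq mult.commute)
  qed
  have hc: "continuous_on UNIV (\<lambda>r. hat d r * g (s + r))" for s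
    by (intro continuous_intros continuous_on_hat continuous_on_compose2[OF cont]) auto
  have hi: "integrable lborel (\<lambda>r. hat d r * g (s + r))" for s
    by (rule integrable_continuous_supported[OF hc, of 0 "2*d"]) (use hat_eq_0[OF d] in auto)
  have hint: "integrable lborel (hat d)"
    by (rule integrable_continuous_supported[OF continuous_on_hat, of 0 "2*d"])
       (use hat_eq_0[OF d] in auto)
  define I where "I = (LINT r|lborel. hat d r)"
  define G where "G s = (LINT r|lborel. hat d r * g (s + r))" for s
  have "0 < d\<^sup>2 / 2" using d by simp
  also have "\<dots> = (LINT r|lborel. indicator {d/2..3*d/2} r *\<^sub>R (d / 2))"
    using d by (simp add: power2_eq_square field_simps)
  also have "\<dots> \<le> I" unfolding I_def
  proof (rule integral_mono)
    show "integrable lborel (\<lambda>r. indicator {d/2..3*d/2} r *\<^sub>R (d / 2))"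
      by (intro integrable_scaleR_left integrable_real_indicator) (auto simp: emeasure_lborel_Icc_eq)
  qed (use hat_ge[OF d] hat_nonneg[OF d] hint in \<open>auto split: split_indicator\<close>)
  finally have I0: "I > 0" .
  have shift: "(LINT r|lborel. hat d (r - s) * g r) = G s"
      and shift_i: "integrable lborel (\<lambda>r. hat d (r - s) * g r)" for s
  proof -
    show "(LINT r|lborel. hat d (r - s) * g r) = G s"
      using lborel_integral_real_affine[of 1 "\<lambda>r. hat d (r - s) * g r" s] by (simp add: G_def)
    show "integrable lborel (\<lambda>r. hat d (r - s) * g r)"
      using lborel_integrable_real_affine[OF hi[of s], of 1 "- s"] by simp
  qed
  have G2: "0 \<le> G s - 2 * G (s + d) + G (s + 2 * d)" if "s \<ge> 0" for s
  proof -
    obtain s' where s': "C2 (spline d) s' (\<lambda>u. 6 * (hat d u - 2 * hat d (u - d) + hat d (u - 2 * d)))"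
      using spline_C2 by blast
    have A: "C2 (\<lambda>r. spline d (r - s)) (\<lambda>r. s' (r - s))
       (\<lambda>r. 6 * (hat d (r - s) - 2 * hat d (r - (s + d)) + hat d (r - (s + 2 * d))))"
      using C2_compose[OF s' C2_affine[of "-s" 1]] by (simp add: algebra_simps)
    have "0 \<le> (LINT r|lborel. 6 * (hat d (r - s) - 2 * hat d (r - (s + d)) + hat d (r - (s + 2 * d))) * g r)"
      by (rule weak[OF A, of "s + 4 * d"]) (use d \<open>s \<ge> 0\<close> in \<open>auto intro!: spline_nonneg spline_eq_0\<close>)
    also have "\<dots> = (LINT r|lborel. 6 * (hat d (r - s) * g r) - 12 * (hat d (r - (s + d)) * g r)
                        + 6 * (hat d (r - (s + 2 * d)) * g r))"
      by (rule Bochner_Integration.integral_cong) (auto simp: algebra_simps)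
    also have "\<dots> = 6 * G s - 12 * G (s + d) + 6 * G (s + 2 * d)"
      using shift_i[of s] shift_i[of "s + d"] shift_i[of "s + 2 * d"] by (simp add: shift)
    finally show ?thesis by simp
  qed
  have Gb: "\<bar>G s\<bar> \<le> B * I" for s
  proof -
    have "\<bar>G s\<bar> \<le> (LINT r|lborel. \<bar>hat d r * g (s + r)\<bar>)"
      unfolding G_def by (rule integral_abs_bound)
    also have "\<dots> \<le> (LINT r|lborel. B * hat d r)"
    proof (rule integral_mono)
      show "integrable lborel (\<lambda>r. \<bar>hat d r * g (s + r)\<bar>)" by (rule integrable_abs[OF hi])
      show "integrable lborel (\<lambda>r. B * hat d r)" using hint by simp
      show "\<bar>hat d r * g (s + r)\<bar> \<le> B * hat d r" for r
        using mult_left_mono[OF bdd[of "s + r"] hat_nonneg[OF d, of r]] hat_nonneg[OF d, of r]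
        by (simp add: abs_mult mult.commute)
    qed
    finally show ?thesis by (simp add: I_def)
  qed
  have "decseq (\<lambda>k. G (t1 + real k * d))"
  proof (rule bounded_discrete_convex_imp_decreasing)
    fix k
    have "t1 + real k * d \<ge> 0" using t d by simp
    from G2[OF this] show "0 \<le> G (t1 + real k * d) - 2 * G (t1 + real (Suc k) * d)
        + G (t1 + real (Suc (Suc k)) * d)"
      by (simp add: algebra_simps)
  qed (rule Gb)
  then have "G (t1 + real n * d) \<le> G (t1 + real 0 * d)" by (rule decseqD) simp
  then have "G t2 \<le> G t1" using n0 by (simp add: d_def)
  moreover have "G t1 \<le> c1 * I"
  proof -
    have "hat d r * g (t1 + r) \<le> c1 * hat d r" for r
    proof (cases "r \<in> {0..2*d}")
      case True
      then have "g (t1 + r) \<le> c1" using e1(2)[of "t1 + r"] d2 by (auto simp: dist_real_def)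
      then show ?thesis by (subst mult.commute) (intro mult_right_mono hat_nonneg[OF d])
    qed (use hat_eq_0[OF d] in auto)
    then show ?thesis unfolding G_def I_def integral_mult_right_zero[symmetric]
      using hi hint by (intro integral_mono) auto
  qed
  moreover have "c2 * I \<le> G t2"
  proof -
    have "c2 * hat d r \<le> hat d r * g (t2 + r)" for r
    proof (cases "r \<in> {0..2*d}")
      case True
      then have "c2 \<le> g (t2 + r)" using e2(2)[of "t2 + r"] d2 by (auto simp: dist_real_def)
      then show ?thesis by (subst mult.commute) (intro mult_left_mono hat_nonneg[OF d])
    qed (use hat_eq_0[OF d] in auto)
    then show ?thesis unfolding G_def I_def integral_mult_right_zero[symmetric]
      using hi hint by (intro integral_mono) auto
  qed
  ultimately have "c2 * I \<le> c1 * I" by linarith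
  then show False using c(2) I0 by simp
qed

lemma nonincreasing_bounded_convergent_at_top:
  fixes g :: "real \<Rightarrow> real"
  assumes mono: "\<And>s t. 0 \<le> s \<Longrightarrow> s \<le> t \<Longrightarrow> g t \<le> g s" and bdd: "\<And>t. \<bar>g t\<bar> \<le> B"
  shows "\<exists>l. (g \<longlongrightarrow> l) at_top"
proof -
  have bb: "bdd_below (g ` {0..})" using bdd by (intro bdd_belowI[of _ "-B"]) (auto simp: abs_le_iff minus_le_iff)
  have "(g \<longlongrightarrow> Inf (g ` {0..})) at_top"
  proof (rule decreasing_tendsto)
    show "\<forall>\<^sub>F t in at_top. Inf (g ` {0..}) \<le> g t"
      using eventually_ge_at_top[of 0] by eventually_elim (auto intro!: cInf_lower bb)
  next
    fix x assume "Inf (g ` {0..}) < x"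
    then obtain s where s: "s \<ge> 0" "g s < x"
      by (subst (asm) cInf_less_iff) (auto intro: bb)
    show "\<forall>\<^sub>F t in at_top. g t < x"
      using eventually_ge_at_top[of s] by eventually_elim (use mono[of s] s in force)
  qed
  then show ?thesis by blast
qed

section \<open>Supports, kernels and test functions\<close>

text \<open>
  The complement of the support is a union of open null sets, and countably many of them cover it.
\<close>
lemma AE_in_spt:
  fixes M :: "'a::second_countable_topology measure"
  assumes sets: "sets M = sets borel"
  shows "AE y in M. y \<in> spt M"
proof -
  let ?F = "{U. open U \<and> emeasure M U = 0}"
  obtain F' where F': "F' \<subseteq> ?F" "countable F'" "\<Union>F' = \<Union>?F"
    using Lindelof[of ?F] by blast
  have "(\<Union>U\<in>F'. U) \<in> null_sets M"
    by (rule null_sets_UN'[OF F'(2)]) (use F'(1) sets in \<open>auto simp: null_sets_def\<close>)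
  moreover have "\<Union>F' = - spt M"
    unfolding F'(3) spt_def by (auto simp: zero_less_iff_neq_zero)
  ultimately have "- spt M \<in> null_sets M" by simp
  then show ?thesis by (rule AE_I') auto
qed

text \<open>
  Time is extended to the whole line by freezing the curve at negative times.  Measurability is
  checked on half-lines, where the distribution function is a limit of integrals of continuous
  steps and each of these is continuous in time.  It is what makes the spatial integrals of the
  velocity measurable functions of time.
\<close>
lemma narrowly_continuous_measurable_kernel:
  assumes rd: "\<And>t. t \<ge> 0 \<Longrightarrow> real_distribution (\<rho> t)" and nc: "narrowly_continuous \<rho>"
  shows "(\<lambda>t. \<rho> (max 0 t)) \<in> borel \<rightarrow>\<^sub>M subprob_algebra borel"
proof -
  have rd': "real_distribution (\<rho> (max 0 t))" for t using rd by simp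
  have step_meas: "(\<lambda>t. LINT y|\<rho> (max 0 t). cts_step a b y) \<in> borel_measurable borel" if "a < b" for a b
  proof -
    have "cts_step a b \<in> C_b"
      using uniformly_continuous_imp_continuous[OF cts_step_uniformly_continuous[OF that]] that
      by (auto simp: C_b_def cts_step_def bounded_iff intro!: exI[of _ 1])
    then have "continuous_on {0..} (\<lambda>t. LINT y|\<rho> t. cts_step a b y)"
      using nc unfolding narrowly_continuous_def by blast
    then have "continuous_on UNIV (\<lambda>t::real. LINT y|\<rho> (max 0 t). cts_step a b y)"
      by (rule continuous_on_compose2) (auto intro!: continuous_intros)
    then show ?thesis by (rule borel_measurable_continuous_onI)
  qed
  have cdf_meas: "(\<lambda>t. cdf (\<rho> (max 0 t)) x) \<in> borel_measurable borel" for x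
  proof (rule borel_measurable_LIMSEQ_real)
    fix t :: real
    interpret real_distribution "\<rho> (max 0 t)" by (rule rd')
    show "(\<lambda>n. LINT y|\<rho> (max 0 t). cts_step x (x + 1 / real (Suc n)) y)
             \<longlonglongrightarrow> cdf (\<rho> (max 0 t)) x"
    proof (rule tendsto_sandwich)
      show "\<forall>\<^sub>F n in sequentially. cdf (\<rho> (max 0 t)) x \<le> (LINT y|\<rho> (max 0 t). cts_step x (x + 1 / real (Suc n)) y)"
        by (auto intro!: always_eventually cdf_cts_step(1))
      show "\<forall>\<^sub>F n in sequentially. (LINT y|\<rho> (max 0 t). cts_step x (x + 1 / real (Suc n)) y) \<le> cdf (\<rho> (max 0 t)) (x + 1 / real (Suc n))"
        by (auto intro!: always_eventually cdf_cts_step(2))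
      have "(\<lambda>n. x + 1 / real (Suc n)) \<longlonglongrightarrow> x + 0"
        by (intro tendsto_intros LIMSEQ_Suc lim_1_over_n)
      then have "filterlim (\<lambda>n. x + 1 / real (Suc n)) (at_right x) sequentially"
        by (auto simp: filterlim_at intro!: always_eventually)
      then show "(\<lambda>n. cdf (\<rho> (max 0 t)) (x + 1 / real (Suc n))) \<longlonglongrightarrow> cdf (\<rho> (max 0 t)) x"
        using cdf_is_right_cont[of x] unfolding continuous_within
        by (rule filterlim_compose[rotated])
    qed simp
  qed (simp add: step_meas)
  show ?thesis
  proof (rule measurable_subprob_algebra_generated[where G = "range atMost" and \<Omega> = UNIV])
    show "sets borel = sigma_sets UNIV (range (atMost :: real \<Rightarrow> real set))"
      by (subst borel_eq_atMost) (simp add: sets_measure_of)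
    show "Int_stable (range (atMost :: real \<Rightarrow> real set))"
      by (auto simp: Int_stable_def min_def intro!: image_eqI)
    fix t :: real
    interpret real_distribution "\<rho> (max 0 t)" by (rule rd')
    show "subprob_space (\<rho> (max 0 t))" by (rule prob_space_imp_subprob_space) unfold_locales
    show "sets (\<rho> (max 0 t)) = sets borel" by simp
  next
    fix A assume "A \<in> range (atMost :: real \<Rightarrow> real set)"
    then obtain x where A: "A = {..x}" by auto
    have "emeasure (\<rho> (max 0 t)) A = ennreal (cdf (\<rho> (max 0 t)) x)" for t
    proof -
      interpret real_distribution "\<rho> (max 0 t)" by (rule rd')
      show ?thesis by (simp add: A cdf_def emeasure_eq_measure)
    qed
    then show "(\<lambda>t. emeasure (\<rho> (max 0 t)) A) \<in> borel_measurable borel"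
      using cdf_meas[of x] by simp
  next
    have "emeasure (\<rho> (max 0 t)) UNIV = 1" for t
    proof -
      interpret real_distribution "\<rho> (max 0 t)" by (rule rd')
      show ?thesis using emeasure_space_1 by simp
    qed
    then show "(\<lambda>t. emeasure (\<rho> (max 0 t)) UNIV) \<in> borel_measurable borel" by simp
  next
    show "range (atMost :: real \<Rightarrow> real set) \<subseteq> Pow UNIV" by simp
  qed
qed

lemma integral_measurable_kernel:
  fixes f :: "'a \<Rightarrow> 'b \<Rightarrow> real"
  assumes f[measurable]: "(\<lambda>(x, y). f x y) \<in> borel_measurable (M \<Otimes>\<^sub>M N)"
    and L[measurable]: "L \<in> M \<rightarrow>\<^sub>M subprob_algebra N"
  shows "(\<lambda>x. LINT y|L x. f x y) \<in> borel_measurable M"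
proof -
  note measurable_distr2[measurable]
  have "(\<lambda>x. integral\<^sup>L (distr (L x) (M \<Otimes>\<^sub>M N) (\<lambda>y. (x, y))) (\<lambda>(x, y). f x y)) \<in> borel_measurable M"
    by measurable
  then show ?thesis
  proof (rule measurable_cong[THEN iffD1, rotated])
    fix x assume x: "x \<in> space M"
    then have [measurable_cong]: "sets (L x) = sets N" using L by (rule sets_kernel[rotated])
    show "integral\<^sup>L (distr (L x) (M \<Otimes>\<^sub>M N) (\<lambda>y. (x, y))) (\<lambda>(x, y). f x y) = (LINT y|L x. f x y)"
      using x by (subst integral_distr) auto
  qed
qed

text \<open>
  Outside the closed interval the function vanishes on an open set, so its derivatives vanish
  there as well.
\<close>
lemma C2_supported_derivatives:
  assumes C: "C2 a a' a''" and supp: "\<And>t. t \<notin> {c..d} \<Longrightarrow> a t = 0" and t: "t \<notin> {c..d}"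
  shows "a' t = 0" "a'' t = 0"
proof -
  have 1: "a' s = 0" if "s \<notin> {c..d}" for s
  proof -
    have "(a has_real_derivative 0) (at s)"
      by (rule has_field_derivative_transform_within_open[of "\<lambda>_. 0" _ _ "- {c..d}"])
         (use that supp in \<open>auto simp: open_Compl\<close>)
    then show ?thesis using C2_D1[OF C, of s UNIV] DERIV_unique by blast
  qed
  show "a' t = 0" using 1 t by blast
  have "(a' has_real_derivative 0) (at t)"
    by (rule has_field_derivative_transform_within_open[of "\<lambda>_. 0" _ _ "- {c..d}"])
       (use t 1 in \<open>auto simp: open_Compl\<close>)
  then show "a'' t = 0" using C2_D2[OF C, of t UNIV] DERIV_unique by blast
qed

text \<open>
  Separated variables suffice: every test function used below is a product of a function of time
  and a function of space.
\<close>
lemma C1c_product: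
  assumes a: "\<And>t. (a has_real_derivative a' t) (at t)" "continuous_on UNIV a'"
    and f: "\<And>y. (f has_real_derivative f' y) (at y)" "continuous_on UNIV f'"
    and supp: "\<And>t. t \<notin> {0..T} \<Longrightarrow> a t = 0" "\<And>y. y \<notin> {c..d} \<Longrightarrow> f y = 0"
  shows "C1c (\<lambda>t y. a t * f y) (\<lambda>t y. a' t * f y) (\<lambda>t y. a t * f' y)"
proof -
  have ca: "continuous_on UNIV a" by (rule DERIV_continuous_on[OF a(1)])
  have cf: "continuous_on UNIV f" by (rule DERIV_continuous_on[OF f(1)])
  have "continuous_on ({0..} \<times> UNIV) (\<lambda>p. p1 (fst p) * p2 (snd p))"
    if "continuous_on UNIV p1" "continuous_on UNIV p2" for p1 p2 :: "real \<Rightarrow> real"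
  proof (rule continuous_on_mult)
    show "continuous_on ({0..} \<times> UNIV) (\<lambda>p. p1 (fst p))"
      by (rule continuous_on_compose2[OF that(1) continuous_on_fst[OF continuous_on_id] subset_UNIV])
    show "continuous_on ({0..} \<times> UNIV) (\<lambda>p. p2 (snd p))"
      by (rule continuous_on_compose2[OF that(2) continuous_on_snd[OF continuous_on_id] subset_UNIV])
  qed
  note * = this
  have "continuous_on ({0..} \<times> UNIV) (\<lambda>(t, y). a' t * f y)"
       "continuous_on ({0..} \<times> UNIV) (\<lambda>(t, y). a t * f' y)"
    unfolding case_prod_unfold by (rule *[OF a(2) cf], rule *[OF ca f(2)])
  moreover have "((\<lambda>s. a s * f y) has_real_derivative a' t * f y) (at t within {0..})" for t y
    by (rule has_field_derivative_at_within, rule DERIV_cmult_right, rule a)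
  moreover have "((\<lambda>z. a t * f z) has_real_derivative a t * f' y) (at y)" for t y
    by (rule DERIV_cmult, rule f)
  moreover have "compact ({0..T} \<times> {c..d})" by (intro compact_Times) auto
  moreover have "a t * f y = 0" if "(t, y) \<notin> {0..T} \<times> {c..d}" for t y
    using that supp by auto
  ultimately show ?thesis unfolding C1c_def by (intro conjI allI impI exI[of _ "{0..T} \<times> {c..d}"]) simp_all
qed

lemma continuous_bounded_on_interval:
  fixes f :: "real \<Rightarrow> real"
  assumes "continuous_on UNIV f"
  obtains B where "B \<ge> 0" "\<And>y. y \<in> {c..d} \<Longrightarrow> \<bar>f y\<bar> \<le> B"
proof -
  have "compact (f ` {c..d})"
    by (rule compact_continuous_image[OF continuous_on_subset[OF assms]]) auto
  then obtain B where "B > 0" "\<forall>y\<in>f ` {c..d}. norm y \<le> B"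
    using compact_imp_bounded bounded_pos by blast
  then show ?thesis using that[of B] by auto
qed

lemma (in real_distribution) continuous_integrable_unit_interval:
  fixes f :: "real \<Rightarrow> real"
  assumes supp: "AE y in M. y \<in> {0..1}" and f: "continuous_on UNIV f"
  shows "integrable M f" "(\<And>y. y \<in> {0..1} \<Longrightarrow> \<bar>f y\<bar> \<le> B) \<Longrightarrow> \<bar>LINT y|M. f y\<bar> \<le> B"
proof -
  have [measurable]: "f \<in> borel_measurable M"
    using borel_measurable_continuous_onI[OF f] by (simp cong: measurable_cong_sets)
  have *: "integrable M f" if "\<And>y. y \<in> {0..1} \<Longrightarrow> \<bar>f y\<bar> \<le> B" for B
    by (rule integrable_const_bound[of _ B]) (use supp that in \<open>auto elim!: AE_mp\<close>)
  show "integrable M f"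
    using continuous_bounded_on_interval[OF f, of 0 1] * by metis
  assume B: "\<And>y. y \<in> {0..1} \<Longrightarrow> \<bar>f y\<bar> \<le> B"
  have "\<bar>LINT y|M. f y\<bar> \<le> (LINT y|M. \<bar>f y\<bar>)" by (rule integral_abs_bound)
  also have "\<dots> \<le> (LINT y|M. B)"
    by (rule integral_mono_AE) (use supp B *[OF B] in \<open>auto elim!: AE_mp\<close>)
  finally show "\<bar>LINT y|M. f y\<bar> \<le> B" by (simp add: prob_space[unfolded space_eq_univ])
qed

text \<open>
  Narrow continuity speaks of bounded functions only.  As the measures live on \<open>[0,1]\<close>, the
  integrand may be composed with the projection onto \<open>[0,1]\<close>, which makes it bounded.
\<close>
lemma continuous_on_integral_narrowly:
  fixes f :: "real \<Rightarrow> real"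
  assumes nc: "narrowly_continuous \<rho>" and rd: "\<And>t. t \<ge> 0 \<Longrightarrow> real_distribution (\<rho> t)"
    and supp: "\<And>t. t \<ge> 0 \<Longrightarrow> AE y in \<rho> t. y \<in> {0..1}" and f: "continuous_on UNIV f"
  shows "continuous_on UNIV (\<lambda>t. LINT y|\<rho> (max 0 t). f y)"
proof -
  define h where "h y = f (max 0 (min 1 y))" for y
  have hc: "continuous_on UNIV h" unfolding h_def
    by (rule continuous_on_compose2[OF f _ subset_UNIV]) (intro continuous_intros)
  obtain B where "\<And>y. y \<in> {0..1} \<Longrightarrow> \<bar>f y\<bar> \<le> B"
    using continuous_bounded_on_interval[OF f, of 0 1] by metis
  then have "\<bar>h y\<bar> \<le> B" for y unfolding h_def by auto
  then have "h \<in> C_b" using hc by (auto simp: C_b_def bounded_iff)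
  then have "continuous_on {0..} (\<lambda>t. LINT y|\<rho> t. h y)"
    using nc unfolding narrowly_continuous_def by blast
  then have "continuous_on UNIV (\<lambda>t::real. LINT y|\<rho> (max 0 t). h y)"
    by (rule continuous_on_compose2) (auto intro!: continuous_intros)
  moreover have "(LINT y|\<rho> (max 0 t). h y) = (LINT y|\<rho> (max 0 t). f y)" for t
  proof -
    interpret real_distribution "\<rho> (max 0 t)" by (rule rd) simp
    show ?thesis
    proof (rule integral_cong_AE)
      show "AE y in \<rho> (max 0 t). h y = f y"
        using supp[of "max 0 t"] by (auto simp: h_def elim!: AE_mp)
    qed (use borel_measurable_continuous_onI[OF f] borel_measurable_continuous_onI[OF hc]
         in \<open>simp_all cong: measurable_cong_sets\<close>)
  qed
  ultimately show ?thesis by simp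
qed

section \<open>Moments of sticky particles solutions\<close>

text \<open>
  Formally, mass conservation gives \<open>d/dt \<integral>\<psi> d\<rho> = \<integral>v \<psi>' d\<rho>\<close>, and the momentum equation gives
  \<open>d/dt \<integral>v \<psi>' d\<rho> = \<integral>v\<^sup>2 \<psi>'' d\<rho>\<close>, which is nonnegative for convex \<open>\<psi>\<close>.  To make this rigorous, the
  first equation is tested with \<open>a' \<psi>\<close> and the second with \<open>a \<psi>'\<close>, where \<open>\<psi>\<close> has been cut off outside
  \<open>[0,1]\<close>; neither test produces an initial term, because \<open>a\<close> and \<open>a'\<close> vanish at time 0.  Subtracting gives
  \<open>\<integral>a'' (\<integral>\<psi> d\<rho>) dt = \<integral>a (\<integral>v\<^sup>2 \<psi>'' d\<rho>) dt\<close>.  The work lies in splitting the integrals, which needs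
  integrability in space (for almost every time) and in time; both follow from the finite energy.
\<close>
lemma sps_weakly_convex:
  assumes sps: "sticky_particles_solution \<rho>0 v0 \<rho> v"
    and supp: "\<And>t. t \<ge> 0 \<Longrightarrow> AE y in \<rho> t. y \<in> {0..1}"
    and psi: "C2 \<psi> \<psi>' \<psi>''" and psi_conv: "\<And>y. y \<in> {0..1} \<Longrightarrow> 0 \<le> \<psi>'' y"
    and a: "C2 a a' a''" and a_nonneg: "\<And>t. 0 \<le> a t"
    and a_supp: "\<And>t. t \<notin> {0<..<T} \<Longrightarrow> a t = 0"
  shows "0 \<le> (LINT t|lborel. a'' t * (LINT y|\<rho> (max 0 t). \<psi> y))"
proof (cases "T > 0")
  case False
  then have "a = (\<lambda>t. 0)" using a_supp by auto
  then have "a'' t = 0" for t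
    using C2_supported_derivatives(2)[OF a, of 1 0 t] by auto
  then show ?thesis by simp
next
  case T: True
  have rd: "\<And>t. t \<ge> 0 \<Longrightarrow> real_distribution (\<rho> t)" and nc: "narrowly_continuous \<rho>"
    and vm: "(\<lambda>(t, y). v t y) \<in> borel_measurable (restrict_space borel ({0..} \<times> UNIV))"
    and L2: "(\<integral>\<^sup>+t\<in>{0..T}. (\<integral>\<^sup>+y. ennreal ((v t y)\<^sup>2) \<partial>\<rho> t) \<partial>lborel) < \<infinity>"
    and mass: "\<And>\<phi> \<phi>t \<phi>y. C1c \<phi> \<phi>t \<phi>y \<Longrightarrow>
        (LINT t:{0..}|lborel. (LINT y|\<rho> t. \<phi>t t y + v t y * \<phi>y t y))
          + (LINT y|\<rho>0. \<phi> 0 y) = 0"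
    and momentum: "\<And>\<phi> \<phi>t \<phi>y. C1c \<phi> \<phi>t \<phi>y \<Longrightarrow>
        (LINT t:{0..}|lborel. (LINT y|\<rho> t. v t y * \<phi>t t y + (v t y)\<^sup>2 * \<phi>y t y))
          + (LINT y|\<rho>0. \<phi> 0 y * v0 y) = 0"
    using sps T unfolding sticky_particles_solution_def by blast+
  \<comment> \<open>Freezing the data at negative times replaces the half-line by the whole line.\<close>
  define R where "R t = \<rho> (max 0 t)" for t
  define w where "w t y = v (max 0 t) y" for t y
  have R_rd: "real_distribution (R t)" for t unfolding R_def by (rule rd) simp
  have R_supp: "AE y in R t. y \<in> {0..1}" for t unfolding R_def by (rule supp) simp
  have kernel[measurable]: "R \<in> borel \<rightarrow>\<^sub>M subprob_algebra borel"
    unfolding R_def[abs_def] by (rule narrowly_continuous_measurable_kernel[OF rd nc])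
  have w_meas[measurable]: "(\<lambda>(t, y). w t y) \<in> borel_measurable (borel \<Otimes>\<^sub>M borel)"
  proof -
    have "(\<lambda>(t::real, y::real). (max 0 t, y)) \<in> borel \<Otimes>\<^sub>M borel \<rightarrow>\<^sub>M borel"
      unfolding borel_prod[symmetric] by measurable
    then have "(\<lambda>(t::real, y::real). (max 0 t, y)) \<in> borel \<Otimes>\<^sub>M borel \<rightarrow>\<^sub>M restrict_space borel ({0..} \<times> UNIV)"
      by (intro measurable_restrict_space2) auto
    from measurable_compose[OF this vm] show ?thesis by (simp add: w_def case_prod_unfold)
  qed
  have w_slice: "w t \<in> borel_measurable borel" for t
    using measurable_compose[OF measurable_Pair1'[of t borel borel] w_meas] by simp

  obtain h h' h'' where h: "C2 h h' h''"
    and h1: "\<And>y. y \<in> {0..1} \<Longrightarrow> h y = 1 \<and> h' y = 0 \<and> h'' y = 0"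
    and h0: "\<And>y. y \<notin> {-2..2} \<Longrightarrow> h y = 0"
    using ex_cutoff by metis
  define p where "p y = h y * \<psi> y" for y
  define p' where "p' y = h' y * \<psi> y + h y * \<psi>' y" for y
  define p'' where "p'' y = h'' y * \<psi> y + 2 * (h' y * \<psi>' y) + h y * \<psi>'' y" for y
  have p: "C2 p p' p''"
    using C2_mult[OF h psi] by (simp add: p_def[abs_def] p'_def[abs_def] p''_def[abs_def])
  have p_eq: "p y = \<psi> y" "p'' y = \<psi>'' y" if "y \<in> {0..1}" for y
    using h1[OF that] by (auto simp: p_def p''_def)
  have p_supp: "p y = 0" "p' y = 0" if "y \<notin> {-2..2}" for y
    using h0 C2_supported_derivatives(1)[OF p, of "-2" 2 y] that by (auto simp: p_def)
  note pc = C2_continuous_on[OF p, of UNIV] and ac = C2_continuous_on[OF a, of UNIV]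
  have a_supp': "a t = 0" "a' t = 0" "a'' t = 0" if "t \<notin> {0..T}" for t
  proof -
    have "a s = 0" if "s \<notin> {0..T}" for s using a_supp that by auto
    then show "a t = 0" "a' t = 0" "a'' t = 0"
      using C2_supported_derivatives[OF a, of 0 T t] that by auto
  qed
  have a0: "a 0 = 0" using a_supp by simp
  \<comment> \<open>A nonnegative function has a minimum at each of its zeros.\<close>
  have a'0: "a' 0 = 0"
    by (rule DERIV_local_min[OF C2_D1[OF a], of 1]) (use a_nonneg a0 in auto)

  define S where "S t = (LINT y|R t. (w t y)\<^sup>2)" for t
  define g where "g t = (LINT y|R t. p y)" for t
  define m where "m t = (LINT y|R t. w t y * p' y)" for t
  define e where "e t = (LINT y|R t. (w t y)\<^sup>2 * p'' y)" for t
  have pm[measurable]: "p \<in> borel_measurable borel" "p' \<in> borel_measurable borel" "p'' \<in> borel_measurable borel"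
    using pc by (auto intro: borel_measurable_continuous_onI)
  have am[measurable]: "a \<in> borel_measurable borel" "a' \<in> borel_measurable borel" "a'' \<in> borel_measurable borel"
    using ac by (auto intro: borel_measurable_continuous_onI)
  have Sm[measurable]: "S \<in> borel_measurable borel"
    unfolding S_def[abs_def] by (rule integral_measurable_kernel[OF _ kernel]) measurable
  have mm[measurable]: "m \<in> borel_measurable borel"
    unfolding m_def[abs_def] by (rule integral_measurable_kernel[OF _ kernel]) measurable
  have em[measurable]: "e \<in> borel_measurable borel"
    unfolding e_def[abs_def] by (rule integral_measurable_kernel[OF _ kernel]) measurable

  define E where "E t = (\<integral>\<^sup>+y. ennreal ((w t y)\<^sup>2) \<partial>R t)" for t
  have Em[measurable]: "E \<in> borel_measurable borel"
    unfolding E_def[abs_def] by (rule nn_integral_measurable_subprob_algebra2[OF _ kernel]) measurable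
  have "(\<integral>\<^sup>+t. E t * indicator {0..T} t \<partial>lborel) =
        (\<integral>\<^sup>+t\<in>{0..T}. (\<integral>\<^sup>+y. ennreal ((v t y)\<^sup>2) \<partial>\<rho> t) \<partial>lborel)"
    by (rule nn_integral_cong) (auto simp: E_def R_def w_def split: split_indicator)
  with L2 have E_fin: "(\<integral>\<^sup>+t. E t * indicator {0..T} t \<partial>lborel) < \<infinity>" by simp
  have "AE t in lborel. E t * indicator {0..T} t \<noteq> \<infinity>"
    by (rule nn_integral_PInf_AE) (use E_fin in auto)
  then have AE_fin: "AE t in lborel. t \<in> {0..T} \<longrightarrow> E t < \<infinity>"
    by eventually_elim (auto simp: less_top)
  have w2_meas: "(\<lambda>y. (w t y)\<^sup>2) \<in> borel_measurable (R t)" "w t \<in> borel_measurable (R t)"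
       "p \<in> borel_measurable (R t)" "p' \<in> borel_measurable (R t)" "p'' \<in> borel_measurable (R t)" for t
  proof -
    interpret real_distribution "R t" by (rule R_rd)
    note w_slice[of t, measurable]
    show "(\<lambda>y. (w t y)\<^sup>2) \<in> borel_measurable (R t)" "w t \<in> borel_measurable (R t)"
       "p \<in> borel_measurable (R t)" "p' \<in> borel_measurable (R t)" "p'' \<in> borel_measurable (R t)"
      by measurable
  qed
  have S_E: "S t = enn2real (E t)" for t
    unfolding S_def E_def by (rule integral_eq_nn_integral[OF w2_meas(1)]) simp
  have S_nonneg: "0 \<le> S t" for t by (simp add: S_E)
  have S_int: "integrable lborel (\<lambda>t. indicator {0..T} t * S t)"
  proof (rule integrableI_nonneg)
    have "(\<integral>\<^sup>+t. ennreal (indicator {0..T} t * S t) \<partial>lborel) \<le> (\<integral>\<^sup>+t. E t * indicator {0..T} t \<partial>lborel)"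
      by (rule nn_integral_mono) (auto simp: S_E ennreal_enn2real_if split: split_indicator)
    then show "(\<integral>\<^sup>+t. ennreal (indicator {0..T} t * S t) \<partial>lborel) < \<infinity>" using E_fin by (rule le_less_trans)
  qed (use S_nonneg in auto)

  \<comment> \<open>Where the kinetic energy is finite, \<open>1 + w\<^sup>2\<close> dominates both \<open>w\<close> and \<open>w\<^sup>2\<close>.\<close>
  obtain D where D: "D \<ge> 0" "\<And>y. y \<in> {0..1} \<Longrightarrow> \<bar>p' y\<bar> \<le> D" "\<And>y. y \<in> {0..1} \<Longrightarrow> \<bar>p'' y\<bar> \<le> D"
  proof -
    obtain D1 where "D1 \<ge> 0" "\<And>y. y \<in> {0..1} \<Longrightarrow> \<bar>p' y\<bar> \<le> D1"
      using continuous_bounded_on_interval[OF pc(2), of 0 1] by metis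
    moreover obtain D2 where "D2 \<ge> 0" "\<And>y. y \<in> {0..1} \<Longrightarrow> \<bar>p'' y\<bar> \<le> D2"
      using continuous_bounded_on_interval[OF pc(3), of 0 1] by metis
    ultimately show ?thesis using that[of "max D1 D2"] by force
  qed
  have slice: "integrable (R t) (\<lambda>y. w t y * p' y)" "integrable (R t) (\<lambda>y. (w t y)\<^sup>2 * p'' y)"
       "integrable (R t) p" "\<bar>m t\<bar> \<le> D * (1 + S t)" "\<bar>e t\<bar> \<le> D * (1 + S t)"
    if fin: "E t < \<infinity>" for t
  proof -
    interpret real_distribution "R t" by (rule R_rd)
    note [measurable] = w2_meas[of t]
    have w2: "integrable (R t) (\<lambda>y. (w t y)\<^sup>2)"
      by (rule integrableI_nonneg) (use fin in \<open>auto simp: E_def\<close>)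
    then have dom: "integrable (R t) (\<lambda>y. D * (1 + (w t y)\<^sup>2))" by simp
    have dom_eq: "(LINT y|R t. D * (1 + (w t y)\<^sup>2)) = D * (1 + S t)"
      using w2 by (simp add: S_def prob_space[unfolded space_eq_univ])
    have w_le: "\<bar>w t y\<bar> \<le> 1 + (w t y)\<^sup>2" for y
    proof -
      have "0 \<le> (\<bar>w t y\<bar> - 1)\<^sup>2" by simp
      then have "2 * \<bar>w t y\<bar> \<le> 1 + (w t y)\<^sup>2" by (simp add: power2_diff)
      then show ?thesis by linarith
    qed
    have b1: "AE y in R t. \<bar>w t y * p' y\<bar> \<le> D * (1 + (w t y)\<^sup>2)"
      using R_supp[of t]
    proof eventually_elim
      case (elim y)
      show ?case
        using mult_mono[OF w_le[of y] D(2)[OF elim]] by (simp add: abs_mult mult.commute)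
    qed
    have b2: "AE y in R t. \<bar>(w t y)\<^sup>2 * p'' y\<bar> \<le> D * (1 + (w t y)\<^sup>2)"
      using R_supp[of t]
    proof eventually_elim
      case (elim y)
      show ?case
        using mult_mono[OF _ D(3)[OF elim], of "(w t y)\<^sup>2" "1 + (w t y)\<^sup>2"] by (simp add: abs_mult mult.commute)
    qed
    show i1: "integrable (R t) (\<lambda>y. w t y * p' y)"
      by (rule Bochner_Integration.integrable_bound[OF dom]) (use b1 in \<open>auto elim!: AE_mp\<close>)
    show i2: "integrable (R t) (\<lambda>y. (w t y)\<^sup>2 * p'' y)"
      by (rule Bochner_Integration.integrable_bound[OF dom]) (use b2 in \<open>auto elim!: AE_mp\<close>)
    show "integrable (R t) p" by (rule continuous_integrable_unit_interval(1)[OF R_supp pc(1)])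
    have "\<bar>m t\<bar> \<le> (LINT y|R t. \<bar>w t y * p' y\<bar>)" unfolding m_def by (rule integral_abs_bound)
    also have "\<dots> \<le> D * (1 + S t)" unfolding dom_eq[symmetric]
      by (rule integral_mono_AE[OF integrable_abs[OF i1] dom b1])
    finally show "\<bar>m t\<bar> \<le> D * (1 + S t)" .
    have "\<bar>e t\<bar> \<le> (LINT y|R t. \<bar>(w t y)\<^sup>2 * p'' y\<bar>)" unfolding e_def by (rule integral_abs_bound)
    also have "\<dots> \<le> D * (1 + S t)" unfolding dom_eq[symmetric]
      by (rule integral_mono_AE[OF integrable_abs[OF i2] dom b2])
    finally show "\<bar>e t\<bar> \<le> D * (1 + S t)" .
  qed
  obtain A where A: "A \<ge> 0" "\<And>t. \<bar>a t\<bar> \<le> A" "\<And>t. \<bar>a' t\<bar> \<le> A"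
  proof -
    obtain A1 where "A1 \<ge> 0" "\<And>t. t \<in> {0..T} \<Longrightarrow> \<bar>a t\<bar> \<le> A1"
      using continuous_bounded_on_interval[OF ac(1), of 0 T] by metis
    moreover obtain A2 where "A2 \<ge> 0" "\<And>t. t \<in> {0..T} \<Longrightarrow> \<bar>a' t\<bar> \<le> A2"
      using continuous_bounded_on_interval[OF ac(2), of 0 T] by metis
    ultimately have "\<bar>a t\<bar> \<le> max A1 A2 \<and> \<bar>a' t\<bar> \<le> max A1 A2" for t
      using a_supp'[of t] by (cases "t \<in> {0..T}") (force simp: le_max_iff_disj)+
    then show ?thesis using that[of "max A1 A2"] \<open>A1 \<ge> 0\<close> by auto
  qed
  have dominated: "integrable lborel (\<lambda>t. b t * k t)"
    if [measurable]: "b \<in> borel_measurable borel" "k \<in> borel_measurable borel"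
      and b: "\<And>t. \<bar>b t\<bar> \<le> A" "\<And>t. t \<notin> {0..T} \<Longrightarrow> b t = 0"
      and k: "\<And>t. E t < \<infinity> \<Longrightarrow> \<bar>k t\<bar> \<le> D * (1 + S t)" for b k :: "real \<Rightarrow> real"
  proof (rule Bochner_Integration.integrable_bound)
    show "integrable lborel (\<lambda>t. A * (D * (indicator {0..T} t + indicator {0..T} t * S t)))"
      using S_int by (intro integrable_mult_right Bochner_Integration.integrable_add integrable_real_indicator)
                     (auto simp: emeasure_lborel_Icc_eq)
    show "AE t in lborel. norm (b t * k t) \<le>
            norm (A * (D * (indicator {0..T} t + indicator {0..T} t * S t)))"
      using AE_fin
    proof eventually_elim
      case (elim t)
      show ?case
      proof (cases "t \<in> {0..T}")
        case True
        then have "\<bar>b t\<bar> * \<bar>k t\<bar> \<le> A * (D * (1 + S t))"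
          using elim b(1)[of t] k[of t] A(1) by (intro mult_mono) auto
        then show ?thesis using True A(1) D(1) S_nonneg[of t] by (simp add: abs_mult)
      qed (simp add: b(2))
    qed
  qed simp
  have gc: "continuous_on UNIV g"
    unfolding g_def[abs_def] R_def by (rule continuous_on_integral_narrowly[OF nc rd supp pc(1)])
  have i_g: "integrable lborel (\<lambda>t. a'' t * g t)"
    by (rule integrable_continuous_supported[of _ 0 T])
       (use ac gc a_supp' in \<open>auto intro!: continuous_intros\<close>)
  have i_m: "integrable lborel (\<lambda>t. a' t * m t)"
    by (rule dominated) (use A a_supp' slice in auto)
  have i_e: "integrable lborel (\<lambda>t. a t * e t)"
    by (rule dominated) (use A a_supp' slice in auto)

  \<comment> \<open>\<open>F\<close> takes the velocity as a separate argument, so that \<open>v\<close> and its extension \<open>w\<close> can be exchanged.\<close>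
  have transfer: "(LINT t:{0..}|lborel. (LINT y|\<rho> t. F t y (v t y))) = (LINT t|lborel. K t)"
    if Fm: "(\<lambda>(t, y). F t y (w t y)) \<in> borel_measurable (borel \<Otimes>\<^sub>M borel)"
      and Km[measurable]: "K \<in> borel_measurable borel"
      and FK: "\<And>t. E t < \<infinity> \<Longrightarrow> (LINT y|R t. F t y (w t y)) = K t"
      and out: "\<And>t y u. t \<notin> {0..T} \<Longrightarrow> F t y u = 0" "\<And>t. t \<notin> {0..T} \<Longrightarrow> K t = 0"
    for F :: "real \<Rightarrow> real \<Rightarrow> real \<Rightarrow> real" and K
  proof -
    have [measurable]: "(\<lambda>t. LINT y|R t. F t y (w t y)) \<in> borel_measurable borel"
      by (rule integral_measurable_kernel[OF Fm kernel])
    have "(LINT t:{0..}|lborel. (LINT y|\<rho> t. F t y (v t y)))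
        = (LINT t|lborel. indicator {0..} t * (LINT y|R t. F t y (w t y)))"
      unfolding set_lebesgue_integral_def
      by (rule Bochner_Integration.integral_cong) (auto simp: R_def w_def split: split_indicator)
    also have "\<dots> = (LINT t|lborel. K t)"
    proof (rule integral_cong_AE)
      show "AE t in lborel. indicator {0..} t * (LINT y|R t. F t y (w t y)) = K t"
        using AE_fin
      proof eventually_elim
        case (elim t)
        then show ?case using FK[of t] out[of t] by (cases "t \<in> {0..T}") auto
      qed
    qed measurable
    finally show ?thesis .
  qed
  have eq1: "(LINT t|lborel. a'' t * g t + a' t * m t) = 0"
  proof -
    have "C1c (\<lambda>t y. a' t * p y) (\<lambda>t y. a'' t * p y) (\<lambda>t y. a' t * p' y)"
      by (rule C1c_product[of _ _ _ _ T "-2" 2])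
         (use C2_D2[OF a] C2_D1[OF p] ac pc a_supp' p_supp in auto)
    from mass[OF this]
    have "0 = (LINT t:{0..}|lborel. (LINT y|\<rho> t. a'' t * p y + v t y * (a' t * p' y)))"
      by (simp add: a'0)
    also have "\<dots> = (LINT t|lborel. a'' t * g t + a' t * m t)"
    proof (rule transfer)
      fix t assume "E t < \<infinity>"
      note i = slice[OF this]
      have "(LINT y|R t. a'' t * p y + w t y * (a' t * p' y))
          = (LINT y|R t. a'' t * p y + a' t * (w t y * p' y))"
        by (simp add: algebra_simps)
      also have "\<dots> = a'' t * g t + a' t * m t"
        unfolding g_def m_def using i(1,3) by simp
      finally show "(LINT y|R t. a'' t * p y + w t y * (a' t * p' y)) = a'' t * g t + a' t * m t" .
    next
      show "(\<lambda>t. a'' t * g t + a' t * m t) \<in> borel_measurable borel"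
        using borel_measurable_continuous_onI[OF gc] by measurable
    next
      show "(\<lambda>(t, y). a'' t * p y + w t y * (a' t * p' y)) \<in> borel_measurable (borel \<Otimes>\<^sub>M borel)"
        by measurable
    qed (use a_supp' in auto)
    finally show ?thesis by simp
  qed
  have eq2: "(LINT t|lborel. a' t * m t + a t * e t) = 0"
  proof -
    have "C1c (\<lambda>t y. a t * p' y) (\<lambda>t y. a' t * p' y) (\<lambda>t y. a t * p'' y)"
      by (rule C1c_product[of _ _ _ _ T "-2" 2])
         (use C2_D1[OF a] C2_D2[OF p] ac pc a_supp' p_supp in auto)
    from momentum[OF this]
    have "0 = (LINT t:{0..}|lborel. (LINT y|\<rho> t. v t y * (a' t * p' y) + (v t y)\<^sup>2 * (a t * p'' y)))"
      by (simp add: a0)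
    also have "\<dots> = (LINT t|lborel. a' t * m t + a t * e t)"
    proof (rule transfer)
      fix t assume "E t < \<infinity>"
      note i = slice[OF this]
      have "(LINT y|R t. w t y * (a' t * p' y) + (w t y)\<^sup>2 * (a t * p'' y))
          = (LINT y|R t. a' t * (w t y * p' y) + a t * ((w t y)\<^sup>2 * p'' y))"
        by (simp add: algebra_simps)
      also have "\<dots> = a' t * m t + a t * e t"
        unfolding e_def m_def using i(1,2) by simp
      finally show "(LINT y|R t. w t y * (a' t * p' y) + (w t y)\<^sup>2 * (a t * p'' y)) = a' t * m t + a t * e t" .
    next
      show "(\<lambda>t. a' t * m t + a t * e t) \<in> borel_measurable borel" by measurable
    next
      show "(\<lambda>(t, y). w t y * (a' t * p' y) + (w t y)\<^sup>2 * (a t * p'' y)) \<in> borel_measurable (borel \<Otimes>\<^sub>M borel)"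
        by measurable
    qed (use a_supp' in auto)
    finally show ?thesis by simp
  qed
  have e_nonneg: "0 \<le> e t" for t
    unfolding e_def
    by (rule integral_nonneg_AE) (use R_supp[of t] psi_conv p_eq in \<open>auto elim!: AE_mp\<close>)
  have "(LINT t|lborel. a'' t * g t) = (LINT t|lborel. a t * e t)"
    using eq1 eq2 i_g i_m i_e by simp
  also have "\<dots> \<ge> 0" by (rule Bochner_Integration.integral_nonneg) (simp add: a_nonneg e_nonneg)
  finally have "0 \<le> (LINT t|lborel. a'' t * g t)" .
  moreover have "g t = (LINT y|\<rho> (max 0 t). \<psi> y)" for t
  proof -
    interpret real_distribution "R t" by (rule R_rd)
    show ?thesis unfolding g_def R_def[symmetric]
    proof (rule integral_cong_AE)
      show "AE y in R t. p y = \<psi> y" using R_supp[of t] p_eq by (auto elim!: AE_mp)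
      show "\<psi> \<in> borel_measurable (R t)"
        using borel_measurable_continuous_onI[OF C2_continuous_on(1)[OF psi]] by (simp cong: measurable_cong_sets)
    qed (rule w2_meas)
  qed
  ultimately show ?thesis by simp
qed

text \<open>
  Confinement bounds the moment, and a bounded weakly convex function of time can only decrease.
\<close>
lemma sps_convex_moment_converges:
  assumes sps: "sticky_particles_solution \<rho>0 v0 \<rho> v"
    and supp: "\<And>t. t \<ge> 0 \<Longrightarrow> AE y in \<rho> t. y \<in> {0..1}"
    and psi: "C2 \<psi> \<psi>' \<psi>''" and psi_conv: "\<And>y. y \<in> {0..1} \<Longrightarrow> 0 \<le> \<psi>'' y"
  shows "\<exists>l. ((\<lambda>t. LINT y|\<rho> (max 0 t). \<psi> y) \<longlongrightarrow> l) at_top"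
proof -
  have rd: "\<And>t. t \<ge> 0 \<Longrightarrow> real_distribution (\<rho> t)" and nc: "narrowly_continuous \<rho>"
    using sps unfolding sticky_particles_solution_def by blast+
  define g where "g t = (LINT y|\<rho> (max 0 t). \<psi> y)" for t
  note pc = C2_continuous_on(1)[OF psi, of UNIV]
  obtain B where "\<And>y. y \<in> {0..1} \<Longrightarrow> \<bar>\<psi> y\<bar> \<le> B"
    using continuous_bounded_on_interval[OF pc, of 0 1] by metis
  then have B: "\<bar>g t\<bar> \<le> B" for t
    unfolding g_def
    by (intro real_distribution.continuous_integrable_unit_interval(2) rd supp pc) auto
  have gc: "continuous_on UNIV g"
    unfolding g_def[abs_def] by (rule continuous_on_integral_narrowly[OF nc rd supp pc])
  have "g t \<le> g s" if "0 \<le> s" "s \<le> t" for s t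
    using that unfolding g_def
    by (intro weakly_convex_bounded_imp_nonincreasing[OF gc[unfolded g_def[abs_def]] B[unfolded g_def]]
              sps_weakly_convex[OF sps supp psi psi_conv])
  from nonincreasing_bounded_convergent_at_top[OF this B] show ?thesis by (simp add: g_def[abs_def])
qed

text \<open>
  Adding a large multiple of \<open>y\<^sup>2\<close> makes any \<open>C\<^sup>2\<close> function convex on \<open>[0,1]\<close>.
\<close>
lemma sps_moment_converges:
  assumes sps: "sticky_particles_solution \<rho>0 v0 \<rho> v"
    and supp: "\<And>t. t \<ge> 0 \<Longrightarrow> AE y in \<rho> t. y \<in> {0..1}"
    and psi: "C2 \<psi> \<psi>' \<psi>''"
  shows "\<exists>l. ((\<lambda>t. LINT y|\<rho> (max 0 t). \<psi> y) \<longlongrightarrow> l) at_top"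
proof -
  have rd: "\<And>t. t \<ge> 0 \<Longrightarrow> real_distribution (\<rho> t)"
    using sps unfolding sticky_particles_solution_def by blast
  obtain M where M: "M \<ge> 0" "\<And>y. y \<in> {0..1} \<Longrightarrow> \<bar>\<psi>'' y\<bar> \<le> M"
    using continuous_bounded_on_interval[OF C2_continuous_on(3)[OF psi], of 0 1] by metis
  note sq = C2_cmult[OF C2_square, of M]
  obtain l1 where l1: "((\<lambda>t. LINT y|\<rho> (max 0 t). \<psi> y + M * y\<^sup>2) \<longlongrightarrow> l1) at_top"
    using sps_convex_moment_converges[OF sps supp C2_add[OF psi sq]] M by fastforce
  obtain l2 where l2: "((\<lambda>t. LINT y|\<rho> (max 0 t). M * y\<^sup>2) \<longlongrightarrow> l2) at_top"
    using sps_convex_moment_converges[OF sps supp sq] M by fastforce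
  have "(LINT y|\<rho> (max 0 t). \<psi> y + M * y\<^sup>2) - (LINT y|\<rho> (max 0 t). M * y\<^sup>2)
      = (LINT y|\<rho> (max 0 t). \<psi> y)" for t
  proof -
    interpret real_distribution "\<rho> (max 0 t)" by (rule rd) simp
    have s: "AE y in \<rho> (max 0 t). y \<in> {0..1}" by (rule supp) simp
    have "integrable (\<rho> (max 0 t)) \<psi>" "integrable (\<rho> (max 0 t)) (\<lambda>y. M * y\<^sup>2)"
      by (rule continuous_integrable_unit_interval(1)[OF s];
          intro C2_continuous_on(1)[OF psi] continuous_intros)+
    then show ?thesis by simp
  qed
  with tendsto_diff[OF l1 l2] show ?thesis by auto
qed

section \<open>Convergence of monotone rearrangements\<close>

text \<open>
  Unless \<open>f\<close> converges to its upper limit, it oscillates for ever across an interval with rational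
  end points just below that limit.
\<close>
lemma bounded_nonoscillating_convergent:
  fixes f :: "real \<Rightarrow> real"
  assumes bdd: "\<And>t. t \<ge> 0 \<Longrightarrow> f t \<in> {c..d}"
    and osc: "\<And>p q. p \<in> \<rat> \<Longrightarrow> q \<in> \<rat> \<Longrightarrow> p < q \<Longrightarrow>
                \<not> ((\<exists>\<^sub>F t in at_top. f t < p) \<and> (\<exists>\<^sub>F t in at_top. q < f t))"
  shows "\<exists>l. (f \<longlongrightarrow> l) at_top"
proof -
  define P where "P = {p. \<forall>\<^sub>F t in at_top. f t \<le> p}"
  have "d \<in> P" unfolding P_def mem_Collect_eq
    by (rule eventually_mono[OF eventually_ge_at_top[of 0]]) (use bdd in auto)
  have lb: "c \<le> p" if "p \<in> P" for p
  proof -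
    have "\<forall>\<^sub>F t in at_top. f t \<le> p \<and> 0 \<le> t"
      using that eventually_ge_at_top[of 0] unfolding P_def by (auto intro: eventually_conj)
    from eventually_happens'[OF trivial_limit_at_top_linorder this]
    obtain t where "f t \<le> p" "0 \<le> t" by blast
    then show ?thesis using bdd[of t] by auto
  qed
  have bb: "bdd_below P" using lb by (rule bdd_belowI)
  have "(f \<longlongrightarrow> Inf P) at_top"
  proof (rule order_tendstoI)
    fix x assume "Inf P < x"
    then obtain p where "p \<in> P" "p < x" using cInf_less_iff[OF _ bb] \<open>d \<in> P\<close> by blast
    then show "\<forall>\<^sub>F t in at_top. f t < x" unfolding P_def by (auto elim: eventually_mono)
  next
    fix x assume x: "x < Inf P"
    obtain p where p: "p \<in> \<rat>" "x < p" "p < Inf P" using Rats_dense_in_real[OF x] by blast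
    obtain q where q: "q \<in> \<rat>" "p < q" "q < Inf P" using Rats_dense_in_real[OF p(3)] by blast
    have "q \<notin> P" using cInf_lower[OF _ bb, of q] q(3) by auto
    then have "\<exists>\<^sub>F t in at_top. q < f t" by (simp add: P_def not_eventually not_le)
    then have "\<not> (\<exists>\<^sub>F t in at_top. f t < p)" using osc[OF p(1) q(1,2)] by blast
    then have "\<forall>\<^sub>F t in at_top. p \<le> f t" by (simp add: not_frequently not_less)
    then show "\<forall>\<^sub>F t in at_top. x < f t" by eventually_elim (use p(2) in simp)
  qed
  then show ?thesis by blast
qed

text \<open>
  Suppose that \<open>X t x\<close> is below \<open>p\<close> at arbitrarily late times and above \<open>q\<close> at other such
  times.  At the former
  times, monotonicity puts \<open>X t\<close> below \<open>p\<close> on all of \<open>(0,x]\<close>, so the integral of the step is at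
  least \<open>x\<close>; at the latter times the step vanishes on \<open>[x,1)\<close>, so the integral is at most \<open>x\<close>.
  The limit of these integrals is therefore \<open>x\<close> itself.  Hence each pair of rationals \<open>p < q\<close>
  accounts for a single point at most.
\<close>
lemma monotone_family_converges_off_countable:
  fixes X :: "real \<Rightarrow> real \<Rightarrow> real"
  assumes mono: "\<And>t. t \<ge> 0 \<Longrightarrow> mono_on {0<..<1} (X t)"
    and range: "\<And>t x. t \<ge> 0 \<Longrightarrow> x \<in> {0<..<1} \<Longrightarrow> X t x \<in> {0..1}"
    and conv: "\<And>p q. p < q \<Longrightarrow>
       \<exists>l. ((\<lambda>t. LINT x:{0<..<1}|lborel. smooth_step p q (X t x)) \<longlongrightarrow> l) at_top"
  shows "countable {x \<in> {0<..<1}. \<nexists>l. ((\<lambda>t. X t x) \<longlongrightarrow> l) at_top}"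
proof -
  define J where "J p q t = (LINT x:{0<..<1}|lborel. smooth_step p q (X t x))" for p q t
  obtain L where L: "\<And>p q. p < q \<Longrightarrow> (J p q \<longlongrightarrow> L p q) at_top"
    using conv unfolding J_def[abs_def] by metis
  have meas: "set_borel_measurable lborel {0<..<1} (\<lambda>x. smooth_step p q (X t x))" if "t \<ge> 0" for t p q
  proof -
    have [measurable]: "X t \<in> borel_measurable (restrict_space borel {0<..<1})"
      by (rule borel_measurable_mono_on_fnc[OF mono[OF that]])
    have [measurable]: "smooth_step p q \<in> borel_measurable borel"
      using smooth_step_C2 C2_continuous_on(1) borel_measurable_continuous_onI by metis
    have "(\<lambda>x. smooth_step p q (X t x)) \<in> borel_measurable (restrict_space borel {0<..<1})"
      by measurable
    then show ?thesis unfolding set_borel_measurable_def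
      by (subst (asm) borel_measurable_restrict_space_iff) auto
  qed
  have int: "set_integrable lborel {0<..<1} (\<lambda>x. smooth_step p q (X t x))" if "t \<ge> 0" for t p q
    unfolding set_integrable_def
  proof (rule Bochner_Integration.integrable_bound)
    show "integrable lborel (indicator {0<..<1::real} :: real \<Rightarrow> real)" by simp
  qed (use meas[OF that] smooth_step_bounds in \<open>auto simp: set_borel_measurable_def split: split_indicator\<close>)
  have unique: "L p q = x"
    if pq: "p < q" and x: "x \<in> {0<..<1}" and lo: "\<exists>\<^sub>F t in at_top. X t x < p"
      and hi: "\<exists>\<^sub>F t in at_top. q < X t x" for p q x
  proof (rule antisym)
    have ge: "x \<le> J p q t" if t: "t \<ge> 0" and "X t x < p" for t
    proof -
      have "smooth_step p q (X t z) = 1" if "z \<in> {0<..x}" for z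
        using mono_onD[OF mono[OF t], of z x] that x \<open>X t x < p\<close>
        by (intro smooth_step_eq_1 pq) auto
      then have "(LINT z|lborel. indicator {0<..x} z) \<le> J p q t"
        using x int[OF t, of p q] smooth_step_bounds(1)
        unfolding J_def set_lebesgue_integral_def set_integrable_def
        by (intro integral_mono) (auto split: split_indicator)
      then show ?thesis using x by simp
    qed
    have le: "J p q t \<le> x" if t: "t \<ge> 0" and "q < X t x" for t
    proof -
      have "smooth_step p q (X t z) = 0" if "z \<in> {x..<1}" for z
        using mono_onD[OF mono[OF t], of x z] that x \<open>q < X t x\<close>
        by (intro smooth_step_eq_0 pq) auto
      then have "J p q t \<le> (LINT z|lborel. indicator {0<..x} z)"
        using x int[OF t, of p q] smooth_step_bounds(2)
        unfolding J_def set_lebesgue_integral_def set_integrable_def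
        by (intro integral_mono) (force split: split_indicator)+
      then show ?thesis using x by simp
    qed
    show "L p q \<le> x"
    proof (rule ccontr)
      assume "\<not> L p q \<le> x"
      then have "\<forall>\<^sub>F t in at_top. x < J p q t" using order_tendstoD(1)[OF L[OF pq]] by simp
      then have "\<forall>\<^sub>F t in at_top. \<not> q < X t x"
        using eventually_ge_at_top[of 0] by eventually_elim (use le in force)
      then show False using hi by (simp add: frequently_def)
    qed
    show "x \<le> L p q"
    proof (rule ccontr)
      assume "\<not> x \<le> L p q"
      then have "\<forall>\<^sub>F t in at_top. J p q t < x" using order_tendstoD(2)[OF L[OF pq]] by simp
      then have "\<forall>\<^sub>F t in at_top. \<not> X t x < p"
        using eventually_ge_at_top[of 0] by eventually_elim (use ge in force)
      then show False using lo by (simp add: frequently_def)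
    qed
  qed
  have "{x \<in> {0<..<1}. \<nexists>l. ((\<lambda>t. X t x) \<longlongrightarrow> l) at_top} \<subseteq> (\<lambda>(p, q). L p q) ` (\<rat> \<times> \<rat>)"
  proof
    fix x assume "x \<in> {x \<in> {0<..<1}. \<nexists>l. ((\<lambda>t. X t x) \<longlongrightarrow> l) at_top}"
    then have x: "x \<in> {0<..<1}" and "\<nexists>l. ((\<lambda>t. X t x) \<longlongrightarrow> l) at_top" by auto
    then obtain p q where "p \<in> \<rat>" "q \<in> \<rat>" "p < q" "\<exists>\<^sub>F t in at_top. X t x < p" "\<exists>\<^sub>F t in at_top. q < X t x"
      using bounded_nonoscillating_convergent[of "\<lambda>t. X t x" 0 1] range by blast
    then show "x \<in> (\<lambda>(p, q). L p q) ` (\<rat> \<times> \<rat>)" using unique[OF _ x] by force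
  qed
  then show ?thesis by (rule countable_subset) (auto intro!: countable_image countable_SIGMA countable_rat)
qed

text \<open>
  The candidate at \<open>x\<close> is the infimum of the limits that exist strictly to the right of \<open>x\<close>; it is
  right-continuous by construction.  It can differ from an existing limit only at one of its own
  jumps, of which there are countably many.
\<close>
lemma monotone_limit_right_continuous_version:
  fixes X :: "real \<Rightarrow> real \<Rightarrow> real"
  assumes mono: "\<And>t. t \<ge> 0 \<Longrightarrow> mono_on {0<..<1} (X t)"
    and range: "\<And>t x. t \<ge> 0 \<Longrightarrow> x \<in> {0<..<1} \<Longrightarrow> X t x \<in> {0..1}"
    and ctbl: "countable {x \<in> {0<..<1}. \<nexists>l. ((\<lambda>t. X t x) \<longlongrightarrow> l) at_top}"
  shows "\<exists>Y. (\<forall>x. Y x \<in> {0..1}) \<and> mono Y \<and> (\<forall>x. continuous (at_right x) Y) \<and>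
           (AE x in lborel. x \<in> {0..1} \<longrightarrow> ((\<lambda>t. X t x) \<longlongrightarrow> Y x) at_top)"
proof -
  \<comment> \<open>Inserting 1 keeps the set nonempty, also for \<open>x = 1\<close>.\<close>
  define V where "V x = insert 1 {l. \<exists>z\<in>{0<..<1}. x < z \<and> ((\<lambda>t. X t z) \<longlongrightarrow> l) at_top}" for x
  define Y where "Y x = Inf (V x)" for x
  have nonneg: "0 \<le> l" if "z \<in> {0<..<1}" "((\<lambda>t. X t z) \<longlongrightarrow> l) at_top" for z l
  proof (rule tendsto_lowerbound[OF that(2)])
    show "\<forall>\<^sub>F t in at_top. 0 \<le> X t z"
      using eventually_ge_at_top[of 0] by eventually_elim (use range that(1) in auto)
  qed simp
  have bb: "bdd_below (V x)" for x
    by (rule bdd_belowI[of _ 0]) (auto simp: V_def nonneg)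
  have Yle: "Y x \<le> l" if "l \<in> V x" for x l unfolding Y_def by (rule cInf_lower[OF that bb])
  have V1: "1 \<in> V x" for x by (simp add: V_def)
  have Y01: "Y x \<in> {0..1}" for x
  proof -
    have "0 \<le> Y x" unfolding Y_def
      by (rule cInf_greatest) (use V1 in \<open>auto simp: V_def nonneg\<close>)
    then show ?thesis using Yle[OF V1] by auto
  qed
  have Ymono: "mono Y"
  proof (rule monoI)
    fix x y :: real assume "x \<le> y"
    have "V y \<subseteq> V x"
    proof
      fix l assume "l \<in> V y"
      then consider "l = 1" | z where "z \<in> {0<..<1}" "y < z" "((\<lambda>t. X t z) \<longlongrightarrow> l) at_top"
        unfolding V_def by blast
      then show "l \<in> V x"
      proof cases
        case 2
        moreover have "x < z" using 2 \<open>x \<le> y\<close> by simp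
        ultimately show ?thesis unfolding V_def by blast
      qed (simp add: V_def)
    qed
    then show "Y x \<le> Y y" unfolding Y_def using V1 bb by (intro cInf_superset_mono) auto
  qed
  have Yright: "continuous (at_right x) Y" for x
    unfolding continuous_within
  proof (rule order_tendstoI)
    fix c assume c: "c < Y x"
    have "c < Y y" if "x < y" for y using c monoD[OF Ymono, of x y] that by simp
    then show "\<forall>\<^sub>F y in at_right x. c < Y y" by (intro eventually_at_rightI[of x "x + 1"]) auto
  next
    fix c assume "Y x < c"
    then obtain l where l: "l \<in> V x" "l < c" unfolding Y_def using cInf_less_iff[OF _ bb] V1 by blast
    show "\<forall>\<^sub>F y in at_right x. Y y < c"
    proof (cases "l = 1")
      case True
      then have "Y y < c" for y using Yle[OF V1[of y]] l(2) by simp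
      then show ?thesis by simp
    next
      case False
      then obtain z where z: "z \<in> {0<..<1}" "x < z" "((\<lambda>t. X t z) \<longlongrightarrow> l) at_top"
        using l(1) by (auto simp: V_def)
      have "Y y < c" if "x < y" "y < z" for y
      proof -
        have "l \<in> V y" unfolding V_def using z(1,3) that(2) by blast
        from Yle[OF this] l(2) show ?thesis by simp
      qed
      then show ?thesis using z(2) by (intro eventually_at_rightI[of x z]) auto
    qed
  qed
  let ?bad = "{x \<in> {0<..<1}. \<nexists>l. ((\<lambda>t. X t x) \<longlongrightarrow> l) at_top} \<union> {x. \<not> isCont Y x} \<union> {0, 1}"
  have "countable ?bad" using ctbl mono_ctble_discont[OF Ymono] by auto
  then have "AE x in lborel. x \<notin> ?bad" by (intro AE_not_in countable_imp_null_set_lborel)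
  then have "AE x in lborel. x \<in> {0..1} \<longrightarrow> ((\<lambda>t. X t x) \<longlongrightarrow> Y x) at_top"
  proof eventually_elim
    case (elim x)
    show ?case
    proof
      assume "x \<in> {0..1}"
      then have x: "x \<in> {0<..<1}" using elim by auto
      then obtain l where l: "((\<lambda>t. X t x) \<longlongrightarrow> l) at_top" using elim by auto
      have l1: "l \<le> 1"
      proof (rule tendsto_upperbound[OF l])
        show "\<forall>\<^sub>F t in at_top. X t x \<le> 1"
          using eventually_ge_at_top[of 0] by eventually_elim (use range x in auto)
      qed simp
      have "l \<le> l'" if z: "z \<in> {0<..<1}" "x < z" "((\<lambda>t. X t z) \<longlongrightarrow> l') at_top" for z l'
      proof (rule tendsto_le[OF _ z(3) l])
        show "\<forall>\<^sub>F t in at_top. X t x \<le> X t z"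
          using eventually_ge_at_top[of 0] by eventually_elim (use mono_onD[OF mono] x z in auto)
      qed simp
      then have "l \<le> Y x" unfolding Y_def using V1 l1 by (intro cInf_greatest) (auto simp: V_def)
      moreover have "Y x \<le> l"
      proof (rule tendsto_upperbound)
        show "(Y \<longlongrightarrow> Y x) (at_left x)"
          using elim by (auto simp: isCont_def intro: tendsto_within_subset)
        have "Y z \<le> l" if "z < x" for z
        proof (rule Yle)
          show "l \<in> V z" unfolding V_def using that l x by blast
        qed
        then show "\<forall>\<^sub>F z in at_left x. Y z \<le> l" by (auto simp: eventually_at_filter)
      qed simp
      ultimately show "((\<lambda>t. X t x) \<longlongrightarrow> Y x) at_top" using l by simp
    qed
  qed
  then show ?thesis using Y01 Ymono Yright by blast
qed

lemma monotone_rearrangement_measurable: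
  assumes "monotone_rearrangement \<mu> X"
  shows "X \<in> borel_measurable (restrict_space lborel {0<..<1})"
proof -
  have "X \<in> borel_measurable (restrict_space borel {0<..<1})"
    using assms unfolding monotone_rearrangement_def by (intro borel_measurable_mono_on_fnc) simp
  moreover have "sets (restrict_space lborel {0<..<1}) = sets (restrict_space borel {0<..<1::real})"
    by (simp add: sets_restrict_space)
  ultimately show ?thesis by (simp cong: measurable_cong_sets)
qed

text \<open>
  The push-forward only gives the bounds almost everywhere, hence at points arbitrarily close to
  \<open>x\<close> on both sides; monotonicity then transports them to \<open>x\<close>.
\<close>
lemma monotone_rearrangement_range:
  assumes X: "monotone_rearrangement \<mu> X" and supp: "AE y in \<mu>. y \<in> {a..b}" and x: "x \<in> {0<..<1}"
  shows "X x \<in> {a..b}"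
proof -
  note Xm = monotone_rearrangement_measurable[OF X]
  have mono: "mono_on {0<..<1} X" and \<mu>: "\<mu> = distr (restrict_space lborel {0<..<1}) borel X"
    using X unfolding monotone_rearrangement_def by auto
  have "AE z in restrict_space lborel {0<..<1}. X z \<in> {a..b}"
    using supp unfolding \<mu> by (subst (asm) AE_distr_iff[OF Xm]) auto
  then have AE: "AE z in lborel. z \<in> {0<..<1} \<longrightarrow> X z \<in> {a..b}"
    by (subst (asm) AE_restrict_space_iff) auto
  have ex: "\<exists>z\<in>{c<..<d}. X z \<in> {a..b}" if "0 \<le> c" "c < d" "d \<le> 1" for c d
  proof (rule ccontr)
    assume "\<not> ?thesis"
    then have "AE z in lborel. z \<notin> {c<..<d}" using AE that by (auto elim!: AE_mp)
    then have "emeasure lborel {c<..<d} = 0"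
      by (subst (asm) AE_iff_measurable[of "{c<..<d}"]) auto
    then show False using that by simp
  qed
  obtain z where "z \<in> {0<..<x}" "X z \<in> {a..b}" using ex[of 0 x] x by auto
  moreover obtain z' where "z' \<in> {x<..<1}" "X z' \<in> {a..b}" using ex[of x 1] x by auto
  ultimately show ?thesis
    using mono_onD[OF mono, of z x] mono_onD[OF mono, of x z'] x by auto
qed

theorem theorem3p1:
  fixes \<rho>0 :: "real measure" and v0 :: "real \<Rightarrow> real"
    and \<rho> :: "real \<Rightarrow> real measure" and v :: "real \<Rightarrow> real \<Rightarrow> real"
    and N :: "real \<Rightarrow> real \<Rightarrow> real"
  assumes "real_distribution \<rho>0" and "spt \<rho>0 \<subseteq> {0..1}"
    and "continuous_on UNIV v0" and "closure {x. v0 x \<noteq> 0} \<subseteq> {0..1}"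
    and "sticky_particles_solution \<rho>0 v0 \<rho> v"
    and "\<And>t. t \<ge> 0 \<Longrightarrow> monotone_rearrangement (\<rho> t) (N t)"
    and "\<And>t. t \<ge> 0 \<Longrightarrow> spt (\<rho> t) \<subseteq> {0..1}"
  shows "\<exists>N_inf :: real \<Rightarrow> real.
           N_inf \<in> {0..1} \<rightarrow> {0..1} \<and> right_continuous_on {0..1} N_inf \<and> mono_on {0..1} N_inf \<and>
           (AE x in lborel. x \<in> {0..1} \<longrightarrow> ((\<lambda>t. N t x) \<longlongrightarrow> N_inf x) at_top)"
proof -
  note sps = assms(5) and N = assms(6)
  have rd: "\<And>t. t \<ge> 0 \<Longrightarrow> real_distribution (\<rho> t)"
    using sps unfolding sticky_particles_solution_def by blast
  have supp: "AE y in \<rho> t. y \<in> {0..1}" if "t \<ge> 0" for t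
  proof -
    have "AE y in \<rho> t. y \<in> spt (\<rho> t)"
      by (rule AE_in_spt[OF real_distribution.events_eq_borel[OF rd[OF that]]])
    then show ?thesis by eventually_elim (use assms(7)[OF that] in blast)
  qed
  have mono: "mono_on {0<..<1} (N t)" if "t \<ge> 0" for t
    using N[OF that] unfolding monotone_rearrangement_def by simp
  have range: "N t x \<in> {0..1}" if "t \<ge> 0" "x \<in> {0<..<1}" for t x
    by (rule monotone_rearrangement_range[OF N supp]) (use that in auto)
  have ctbl: "countable {x \<in> {0<..<1}. \<nexists>l. ((\<lambda>t. N t x) \<longlongrightarrow> l) at_top}"
  proof (rule monotone_family_converges_off_countable[OF mono range])
    fix p q :: real assume "p < q"
    obtain s' s'' where s: "C2 (smooth_step p q) s' s''" using smooth_step_C2 by blast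
    obtain l where l: "((\<lambda>t. LINT y|\<rho> (max 0 t). smooth_step p q y) \<longlongrightarrow> l) at_top"
      using sps_moment_converges[OF sps supp s] by blast
    have "(LINT y|\<rho> (max 0 t). smooth_step p q y) = (LINT x:{0<..<1}|lborel. smooth_step p q (N t x))"
      if "t \<ge> 0" for t
    proof -
      have sm: "smooth_step p q \<in> borel_measurable borel"
        by (rule borel_measurable_continuous_onI[OF C2_continuous_on(1)[OF s]])
      have "\<rho> t = distr (restrict_space lborel {0<..<1}) borel (N t)"
        using N[OF that] unfolding monotone_rearrangement_def by simp
      then have "(LINT y|\<rho> t. smooth_step p q y) = (LINT x|restrict_space lborel {0<..<1}. smooth_step p q (N t x))"
        using integral_distr[OF monotone_rearrangement_measurable[OF N[OF that]] sm] by simp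
      also have "\<dots> = (LINT x:{0<..<1}|lborel. smooth_step p q (N t x))"
        unfolding set_lebesgue_integral_def by (subst integral_restrict_space) auto
      finally show ?thesis using that by simp
    qed
    then have "\<forall>\<^sub>F t in at_top. (LINT y|\<rho> (max 0 t). smooth_step p q y) = (LINT x:{0<..<1}|lborel. smooth_step p q (N t x))"
      by (rule eventually_mono[OF eventually_ge_at_top[of 0]])
    from Lim_transform_eventually[OF l this]
    show "\<exists>l. ((\<lambda>t. LINT x:{0<..<1}|lborel. smooth_step p q (N t x)) \<longlongrightarrow> l) at_top" by blast
  qed
  obtain Y where Y: "\<And>x. Y x \<in> {0..1}" "mono Y" "\<And>x. continuous (at_right x) Y"
    "AE x in lborel. x \<in> {0..1} \<longrightarrow> ((\<lambda>t. N t x) \<longlongrightarrow> Y x) at_top"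
    using monotone_limit_right_continuous_version[OF mono range ctbl] by blast
  have "right_continuous_on {0..1} Y"
    unfolding right_continuous_on_def
  proof
    fix x :: real assume "x \<in> {0..1}"
    have "continuous (at x within {x..}) Y"
      using Y(3)[of x] unfolding continuous_within
      by (simp add: at_within_Ici_at_right)
    then show "continuous (at x within {0..1} \<inter> {x..}) Y" by (rule continuous_within_subset) auto
  qed
  then show ?thesis using Y by (intro exI[of _ Y]) (auto intro: mono_imp_mono_on)
qed

end
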